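(* Let $\mathcal O$ be a straight $W$-conjugacy class of $\tilde W$. Then for any $\tilde w,\tilde w'\in\mathcal O_{\min}$ we have $\tilde w\approx\tilde w'$.
   Context: Setting: $W=Q\rtimes W_0$ affine Weyl group of a reduced root system (Coxeter group with affine simple reflections $S$), $\tilde W=P\rtimes(W_0\rtimes\Omega')$ for a connected complex reductive group with coweight lattice $P$ and finite group $\Omega'$ of diagram automorphisms; $\ell$ the length on $\tilde W$ (number of affine root hyperplanes separating the fundamental alcove from its image). $\mathcal O_{\min}$ = elements of minimal length in $\mathcal O$. $\tilde w$ is straight if $\ell(\tilde w^m)=m\ell(\tilde w)$ for all $m\ge0$; a class is straight if it contains a straight element. For $s\in S$, $w\xrightarrow{s}w'$ means $w'=sws$ and $\ell(w')\le\ell(w)$; $w\to w'$ means a finite chain of such steps; $w\approx w'$ means $w\to w'$ and $w'\to w$. *)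

theory Defs
  imports "HOL-Analysis.Analysis"
begin

text \<open>Geometric model of the (extended) affine Weyl group.  V is a real
Euclidean space ('a); roots are vectors of V, the pairing between roots and
coweights is the inner product (a W_0- and Omega'-invariant inner product).\<close>

definition coroot :: "'a::euclidean_space \<Rightarrow> 'a" where
  "coroot \<alpha> = (2 / (\<alpha> \<bullet> \<alpha>)) *\<^sub>R \<alpha>"

definition refl :: "'a::euclidean_space \<Rightarrow> 'a \<Rightarrow> 'a" where
  "refl \<alpha> x = x - (\<alpha> \<bullet> x) *\<^sub>R coroot \<alpha>"

text \<open>A reduced (finite, crystallographic) root system, not necessarily spanning V.\<close>
definition reduced_root_system :: "'a::euclidean_space set \<Rightarrow> bool" where
  "reduced_root_system \<Phi> \<longleftrightarrow> finite \<Phi> \<and> 0 \<notin> \<Phi> \<and>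
     (\<forall>\<alpha>\<in>\<Phi>. refl \<alpha> ` \<Phi> = \<Phi>) \<and>
     (\<forall>\<alpha>\<in>\<Phi>. \<forall>\<beta>\<in>\<Phi>. \<beta> \<bullet> coroot \<alpha> \<in> \<int>) \<and>
     (\<forall>\<alpha>\<in>\<Phi>. \<forall>c::real. c *\<^sub>R \<alpha> \<in> \<Phi> \<longrightarrow> c = 1 \<or> c = -1)"

definition positive_system :: "'a::euclidean_space set \<Rightarrow> 'a set \<Rightarrow> bool" where
  "positive_system \<Phi> \<Phi>p \<longleftrightarrow> (\<exists>\<rho>. (\<forall>\<alpha>\<in>\<Phi>. \<alpha> \<bullet> \<rho> \<noteq> 0) \<and> \<Phi>p = {\<alpha>\<in>\<Phi>. \<alpha> \<bullet> \<rho> > 0})"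

text \<open>The coweight (cocharacter) lattice P of a connected reductive group with root
system \<Phi>: a full-rank lattice in V containing the coroots, on which the roots are
integral (i.e. (dual of P, \<Phi>, P, coroots) is a root datum).\<close>
definition coweight_lattice :: "'a::euclidean_space set \<Rightarrow> 'a set \<Rightarrow> bool" where
  "coweight_lattice \<Phi> P \<longleftrightarrow> 0 \<in> P \<and> (\<forall>p\<in>P. \<forall>q\<in>P. p + q \<in> P \<and> - p \<in> P) \<and>
     (\<exists>e>0. \<forall>p\<in>P. p \<noteq> 0 \<longrightarrow> e \<le> norm p) \<and> span P = UNIV \<and>
     (\<forall>\<alpha>\<in>\<Phi>. coroot \<alpha> \<in> P) \<and> (\<forall>\<alpha>\<in>\<Phi>. \<forall>p\<in>P. \<alpha> \<bullet> p \<in> \<int>)"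

definition diagram_group :: "'a::euclidean_space set \<Rightarrow> 'a set \<Rightarrow> ('a \<Rightarrow> 'a) set \<Rightarrow> bool" where
  "diagram_group \<Phi>p P \<Omega> \<longleftrightarrow> finite \<Omega> \<and> id \<in> \<Omega> \<and> (\<forall>u\<in>\<Omega>. \<forall>v\<in>\<Omega>. u \<circ> v \<in> \<Omega>) \<and>
     (\<forall>u\<in>\<Omega>. linear u \<and> (\<forall>x y. u x \<bullet> u y = x \<bullet> y) \<and> u ` P = P \<and> u ` \<Phi>p = \<Phi>p)"

inductive_set W0 :: "'a::euclidean_space set \<Rightarrow> ('a \<Rightarrow> 'a) set" for \<Phi> where
  W0_id: "id \<in> W0 \<Phi>"
| W0_refl: "u \<in> W0 \<Phi> \<Longrightarrow> \<alpha> \<in> \<Phi> \<Longrightarrow> refl \<alpha> \<circ> u \<in> W0 \<Phi>"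

inductive_set coroot_lattice :: "'a::euclidean_space set \<Rightarrow> 'a set" for \<Phi> where
  Q_zero: "0 \<in> coroot_lattice \<Phi>"
| Q_plus: "q \<in> coroot_lattice \<Phi> \<Longrightarrow> \<alpha> \<in> \<Phi> \<Longrightarrow> q + coroot \<alpha> \<in> coroot_lattice \<Phi>"
| Q_minus: "q \<in> coroot_lattice \<Phi> \<Longrightarrow> \<alpha> \<in> \<Phi> \<Longrightarrow> q - coroot \<alpha> \<in> coroot_lattice \<Phi>"

definition Wext :: "'a::euclidean_space set \<Rightarrow> 'a set \<Rightarrow> ('a \<Rightarrow> 'a) set \<Rightarrow> ('a \<Rightarrow> 'a) set" where
  "Wext \<Phi> P \<Omega> = {(\<lambda>x. p + u (v x)) | p u v. p \<in> P \<and> u \<in> W0 \<Phi> \<and> v \<in> \<Omega>}"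

definition Waff :: "'a::euclidean_space set \<Rightarrow> ('a \<Rightarrow> 'a) set" where
  "Waff \<Phi> = {(\<lambda>x. q + u x) | q u. q \<in> coroot_lattice \<Phi> \<and> u \<in> W0 \<Phi>}"

definition alcove :: "'a::euclidean_space set \<Rightarrow> 'a set" where
  "alcove \<Phi>p = {x. \<forall>\<alpha>\<in>\<Phi>p. 0 < \<alpha> \<bullet> x \<and> \<alpha> \<bullet> x < 1}"

definition separates :: "'a::euclidean_space set \<Rightarrow> ('a \<Rightarrow> 'a) \<Rightarrow> 'a \<Rightarrow> int \<Rightarrow> bool" where
  "separates \<Phi>p w \<alpha> k \<longleftrightarrow>
     ((\<forall>x\<in>alcove \<Phi>p. \<alpha> \<bullet> x < of_int k) \<and> (\<forall>x\<in>alcove \<Phi>p. \<alpha> \<bullet> w x > of_int k)) \<or>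
     ((\<forall>x\<in>alcove \<Phi>p. \<alpha> \<bullet> x > of_int k) \<and> (\<forall>x\<in>alcove \<Phi>p. \<alpha> \<bullet> w x < of_int k))"

definition len :: "'a::euclidean_space set \<Rightarrow> ('a \<Rightarrow> 'a) \<Rightarrow> nat" where
  "len \<Phi>p w = card {(\<alpha>, k). \<alpha> \<in> \<Phi>p \<and> separates \<Phi>p w \<alpha> k}"

definition affrefl :: "'a::euclidean_space \<Rightarrow> int \<Rightarrow> 'a \<Rightarrow> 'a" where
  "affrefl \<alpha> k x = x - (\<alpha> \<bullet> x - of_int k) *\<^sub>R coroot \<alpha>"

definition is_wall :: "'a::euclidean_space set \<Rightarrow> 'a \<Rightarrow> int \<Rightarrow> bool" where
  "is_wall \<Phi>p \<alpha> k \<longleftrightarrow> (\<exists>x. \<alpha> \<bullet> x = of_int k \<and> (\<exists>e>0.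
      (\<forall>y\<in>ball x e. \<alpha> \<bullet> y > of_int k \<longrightarrow> y \<in> alcove \<Phi>p) \<or>
      (\<forall>y\<in>ball x e. \<alpha> \<bullet> y < of_int k \<longrightarrow> y \<in> alcove \<Phi>p)))"

definition Ssimple :: "'a::euclidean_space set \<Rightarrow> 'a set \<Rightarrow> ('a \<Rightarrow> 'a) set" where
  "Ssimple \<Phi> \<Phi>p = {affrefl \<alpha> k | \<alpha> k. \<alpha> \<in> \<Phi> \<and> is_wall \<Phi>p \<alpha> k}"

definition cstep :: "'a::euclidean_space set \<Rightarrow> 'a set \<Rightarrow> ('a \<Rightarrow> 'a) \<Rightarrow> ('a \<Rightarrow> 'a) \<Rightarrow> bool" where
  "cstep \<Phi> \<Phi>p w w' \<longleftrightarrow> (\<exists>s\<in>Ssimple \<Phi> \<Phi>p. w' = s \<circ> w \<circ> s \<and> len \<Phi>p w' \<le> len \<Phi>p w)"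

definition reaches :: "'a::euclidean_space set \<Rightarrow> 'a set \<Rightarrow> ('a \<Rightarrow> 'a) \<Rightarrow> ('a \<Rightarrow> 'a) \<Rightarrow> bool" where
  "reaches \<Phi> \<Phi>p = (cstep \<Phi> \<Phi>p)\<^sup>*\<^sup>*"

definition approx :: "'a::euclidean_space set \<Rightarrow> 'a set \<Rightarrow> ('a \<Rightarrow> 'a) \<Rightarrow> ('a \<Rightarrow> 'a) \<Rightarrow> bool" where
  "approx \<Phi> \<Phi>p w w' \<longleftrightarrow> reaches \<Phi> \<Phi>p w w' \<and> reaches \<Phi> \<Phi>p w' w"

definition straight :: "'a::euclidean_space set \<Rightarrow> ('a \<Rightarrow> 'a) \<Rightarrow> bool" where
  "straight \<Phi>p w \<longleftrightarrow> (\<forall>m. len \<Phi>p (w ^^ m) = m * len \<Phi>p w)"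

definition conj_class :: "'a::euclidean_space set \<Rightarrow> ('a \<Rightarrow> 'a) \<Rightarrow> ('a \<Rightarrow> 'a) set" where
  "conj_class \<Phi> w = {x \<circ> w \<circ> inv x | x. x \<in> Waff \<Phi>}"

definition min_elems :: "'a::euclidean_space set \<Rightarrow> ('a \<Rightarrow> 'a) set \<Rightarrow> ('a \<Rightarrow> 'a) set" where
  "min_elems \<Phi>p Cl = {w \<in> Cl. \<forall>w'\<in>Cl. len \<Phi>p w \<le> len \<Phi>p w'}"

end

theory Submission
  imports Defs
begin

text \<open>
  Fix \<open>w\<close> in the extended group. Conjugates of \<open>w\<close> by the affine Weyl group correspond to alcoves
  \<open>A\<close>, with length the number \<open>d (A, w A)\<close> of hyperplanes between \<open>A\<close> and \<open>w A\<close>; conjugation by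
  a simple reflection is the passage to an adjacent alcove. Let \<open>\<nu>\<close> be the Newton point of \<open>w\<close>.

  An alcove is straight iff no half-space \<open>\<alpha> > k\<close> with \<open>\<alpha> \<bullet> \<nu> \<le> 0\<close> is entered between \<open>A\<close> and
  \<open>w A\<close>; straight alcoves have minimal length, so in a straight class they are exactly the minimal
  ones. Every straight alcove lies in a \<open>w\<close>-stable chamber \<open>C\<close> of the arrangement of the hyperplanes
  parallel to \<open>\<nu>\<close>. The reflection group of this arrangement acts simply transitively on its
  chambers, so an element carrying one \<open>w\<close>-stable chamber to another commutes with \<open>w\<close>, and one
  may assume that both given alcoves lie in the same \<open>C\<close>.

  Moving a point \<open>x\<close> to \<open>(2 x + w x) / 3\<close> is a sequence of cyclic shifts. Iterating it makes
  \<open>w x - x\<close> converge to \<open>\<nu>\<close> (as far as roots can see), so \<open>x\<close> ends up in the convex open set \<open>U\<close>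
  of points where \<open>\<alpha> \<bullet> w x < \<alpha> \<bullet> x\<close> for all roots with \<open>\<alpha> \<bullet> \<nu> < 0\<close>. All alcoves meeting
  \<open>U \<inter> C\<close> are straight, and any two of them are joined by a gallery of such alcoves.

  Alcoves are represented by regular points up to having the same floors \<open>\<lfloor>\<alpha> \<bullet> x\<rfloor>\<close>, and
  hyperplanes by half-spaces \<open>(\<alpha>, k)\<close>, so that \<open>sep x y\<close> lists each hyperplane between \<open>x\<close> and \<open>y\<close>
  exactly once.
\<close>

section \<open>Preliminaries: generic points, affine reflections, an averaging recursion\<close>

lemma generic_point:
  fixes \<gamma> :: "'i \<Rightarrow> 'a::euclidean_space"
  assumes "countable I" "\<And>i. i \<in> I \<Longrightarrow> \<gamma> i \<noteq> 0" "open U" "U \<noteq> {}"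
  obtains x where "x \<in> U" "\<And>i. i \<in> I \<Longrightarrow> \<gamma> i \<bullet> x \<noteq> c i"
proof -
  have "negligible (\<Union>i\<in>I. {x. \<gamma> i \<bullet> x = c i})"
    using assms by (intro negligible_countable_Union) (auto intro!: negligible_hyperplane)
  then have "\<not> U \<subseteq> (\<Union>i\<in>I. {x. \<gamma> i \<bullet> x = c i})"
    using assms open_not_negligible negligible_subset by blast
  then show thesis using that by blast
qed

lemma coroot_orthogonal:
  assumes "orthogonal_transformation L"
  shows "coroot (L \<alpha>) = L (coroot \<alpha>)"
  using assms by (simp add: coroot_def orthogonal_transformation_def linear_cmul)

lemma inner_affrefl:
  assumes "\<alpha> \<noteq> 0"
  shows "\<alpha> \<bullet> affrefl \<alpha> k x = 2 * of_int k - \<alpha> \<bullet> x"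
  using assms by (simp add: affrefl_def coroot_def inner_diff_right field_simps)

lemma affrefl_involutive [simp]:
  assumes "\<alpha> \<noteq> 0"
  shows "affrefl \<alpha> k (affrefl \<alpha> k x) = x"
proof -
  have "affrefl \<alpha> k (affrefl \<alpha> k x)
      = affrefl \<alpha> k x - (of_int k - \<alpha> \<bullet> x) *\<^sub>R coroot \<alpha>"
    using inner_affrefl[OF assms] by (simp add: affrefl_def[of \<alpha> k "affrefl \<alpha> k x"])
  then show ?thesis by (simp add: affrefl_def algebra_simps)
qed

lemma affrefl_uminus: "affrefl (- \<alpha>) (- k) = affrefl \<alpha> k"
  by (rule ext) (simp add: affrefl_def coroot_def algebra_simps flip: scaleR_add_left add_divide_distrib)

lemma affrefl_eq_self: "\<alpha> \<bullet> x = of_int k \<Longrightarrow> affrefl \<alpha> k x = x"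
  by (simp add: affrefl_def)

lemma orthogonal_transformation_refl:
  assumes "\<alpha> \<noteq> 0"
  shows "orthogonal_transformation (refl \<alpha>)"
  unfolding orthogonal_transformation_def
proof (intro conjI allI)
  show "linear (refl \<alpha>)"
    by (rule linearI) (simp_all add: refl_def algebra_simps)
  show "refl \<alpha> v \<bullet> refl \<alpha> w = v \<bullet> w" for v w
    using assms by (simp add: refl_def coroot_def inner_diff_left inner_diff_right inner_commute field_simps)
qed

lemma affrefl_eq_refl: "affrefl \<alpha> k = (\<lambda>x. of_int k *\<^sub>R coroot \<alpha> + refl \<alpha> x)"
  by (rule ext) (simp add: affrefl_def refl_def algebra_simps)

lemma dist_affrefl:
  assumes "\<alpha> \<noteq> 0"
  shows "dist (affrefl \<alpha> k x) (affrefl \<alpha> k y) = dist x y"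
  using orthogonal_transformation_refl[OF assms]
  by (simp add: affrefl_eq_refl orthogonal_transformation_isometry)

lemma floor_uminus:
  assumes "(a::real) \<notin> \<int>"
  shows "\<lfloor>- a\<rfloor> = - \<lfloor>a\<rfloor> - 1"
proof -
  have "of_int \<lfloor>a\<rfloor> \<noteq> a" using assms by (metis Ints_of_int)
  then show ?thesis by linarith
qed

text \<open>The energy \<open>\<Sum>i<n. (F k i)\<^sup>2\<close> drops by \<open>2/9\<close> of the sum of the squared differences, so the
  differences tend to zero, and with them the terms, as their mean vanishes.\<close>
lemma averaging_tendsto_zero:
  fixes F :: "nat \<Rightarrow> nat \<Rightarrow> real"
  assumes n: "n > 0"
    and step: "\<And>k i. F (Suc k) i = (2 * F k i + F k (Suc i)) / 3"
    and per: "\<And>k i. F k (i + n) = F k i"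
    and mean: "\<And>k. (\<Sum>i<n. F k i) = 0"
  shows "(\<lambda>k. F k 0) \<longlonglongrightarrow> 0"
proof -
  define E where "E k = (\<Sum>i<n. (F k i)\<^sup>2)" for k
  have shift: "(\<Sum>i<n. (F k (Suc i))\<^sup>2) = E k" for k
  proof -
    have "(\<Sum>i<n. (F k (Suc i))\<^sup>2) = (\<Sum>i<Suc n. (F k i)\<^sup>2) - (F k 0)\<^sup>2"
      by (simp only: sum.lessThan_Suc_shift)
    also have "\<dots> = E k" using per[of k 0] by (simp add: E_def)
    finally show ?thesis .
  qed
  have drop: "E k - E (Suc k) = 2 / 9 * (\<Sum>i<n. (F k (Suc i) - F k i)\<^sup>2)" for k
  proof -
    have pt: "(F k i)\<^sup>2 - (F (Suc k) i)\<^sup>2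
        = 2 / 9 * (F k (Suc i) - F k i)\<^sup>2 + (1 / 3) * ((F k i)\<^sup>2 - (F k (Suc i))\<^sup>2)" for i
      unfolding step by (simp add: power2_eq_square field_simps)
    have "E k - E (Suc k) = (\<Sum>i<n. (F k i)\<^sup>2 - (F (Suc k) i)\<^sup>2)"
      by (simp add: E_def sum_subtractf)
    also have "\<dots> = 2 / 9 * (\<Sum>i<n. (F k (Suc i) - F k i)\<^sup>2) + (1 / 3) * (E k - (\<Sum>i<n. (F k (Suc i))\<^sup>2))"
      unfolding pt by (simp only: sum.distrib sum_subtractf E_def flip: sum_distrib_left)
    finally show ?thesis unfolding shift by simp
  qed
  have "decseq E"
  proof (rule decseq_SucI)
    show "E (Suc k) \<le> E k" for k
      using drop[of k] sum_nonneg[of "{..<n}" "\<lambda>i. (F k (Suc i) - F k i)\<^sup>2"] by simp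
  qed
  then obtain l where l: "E \<longlonglongrightarrow> l"
    using decseq_convergent[of E 0] by (auto simp: E_def sum_nonneg)
  have "(\<lambda>k. E k - E (Suc k)) \<longlonglongrightarrow> l - l"
    by (intro tendsto_diff l LIMSEQ_Suc)
  then have "(\<lambda>k. 9 / 2 * (E k - E (Suc k))) \<longlonglongrightarrow> 0"
    using tendsto_mult_right_zero by fastforce
  then have D: "(\<lambda>k. \<Sum>i<n. (F k (Suc i) - F k i)\<^sup>2) \<longlonglongrightarrow> 0"
    unfolding drop by simp
  have diff: "(\<lambda>k. F k (Suc i) - F k i) \<longlonglongrightarrow> 0" if "i < n" for i
  proof -
    have "(\<lambda>k. (F k (Suc i) - F k i)\<^sup>2) \<longlonglongrightarrow> 0"
    proof (rule tendsto_sandwich[OF _ _ tendsto_const D])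
      show "\<forall>\<^sub>F k in sequentially. (F k (Suc i) - F k i)\<^sup>2 \<le> (\<Sum>i<n. (F k (Suc i) - F k i)\<^sup>2)"
        using that by (intro always_eventually allI member_le_sum) auto
    qed simp
    then show ?thesis by simp
  qed
  have d0: "(\<lambda>k. F k j - F k 0) \<longlonglongrightarrow> 0" if "j < n" for j
    using that
  proof (induction j)
    case (Suc j)
    have "(\<lambda>k. (F k (Suc j) - F k j) + (F k j - F k 0)) \<longlonglongrightarrow> 0 + 0"
      using Suc by (intro tendsto_add diff) auto
    then show ?case by simp
  qed simp
  have "(\<lambda>k. \<Sum>j<n. F k j - F k 0) \<longlonglongrightarrow> (\<Sum>j<n. 0)"
    by (intro tendsto_sum d0) simp
  then have "(\<lambda>k. (- 1 / n) * (\<Sum>j<n. F k j - F k 0)) \<longlonglongrightarrow> (- 1 / n) * 0"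
    by (intro tendsto_mult tendsto_const) simp
  moreover have "(- 1 / n) * (\<Sum>j<n. F k j - F k 0) = F k 0" for k
    using mean[of k] n by (simp add: sum_subtractf)
  ultimately show ?thesis by simp
qed

text \<open>Pigeonhole: the powers of \<open>L\<close>, restricted to \<open>A\<close>, form a
  finite set, so two of them agree. The restriction matters because \<open>L\<close> may have
  infinite order off \<open>A\<close>.\<close>

lemma finite_permutation_order:
  assumes "finite A" "L ` A = A"
  obtains n :: nat where "n > 0" "\<forall>x\<in>A. (L ^^ n) x = x"
proof -
  have img: "(L ^^ i) ` A = A" for i
    by (induction i) (simp_all only: funpow.simps image_ident id_def image_comp[symmetric] assms(2))
  have inji: "inj_on (L ^^ i) A" for i
    using img[of i] assms(1) by (metis eq_card_imp_inj_on)
  define f where "f i = restrict (L ^^ i) A" for i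
  have "(L ^^ i) x \<in> A" if "x \<in> A" for i x using img[of i] that by blast
  then have "range f \<subseteq> A \<rightarrow>\<^sub>E A" unfolding f_def by auto
  then have "finite (range f)"
    by (rule finite_subset) (use assms(1) in \<open>auto intro: finite_PiE\<close>)
  then have "\<not> inj f" using finite_imageD infinite_UNIV_nat by blast
  then obtain i j where "f i = f j" "i \<noteq> j" unfolding inj_def by blast
  then obtain i j where ij: "f i = f j" "i < j" by (metis linorder_neqE_nat)
  define n where "n = j - i"
  have "(L ^^ n) x = x" if "x \<in> A" for x
  proof -
    have "(L ^^ i) ((L ^^ n) x) = (L ^^ j) x"
      using ij(2) by (metis n_def comp_apply funpow_add le_add_diff_inverse less_imp_le)
    also have "\<dots> = (L ^^ i) x" using fun_cong[OF ij(1), of x] that by (simp add: f_def)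
    finally show ?thesis using inji[of i] img[of n] that by (metis image_eqI inj_onD)
  qed
  then show thesis using that[of n] ij(2) by (simp add: n_def)
qed

text \<open>The unequal weights keep the map injective when \<open>w\<close> is an affine isometry;
  a midpoint would collapse directions that the linear part negates. Injectivity lets generic points
  stay generic under iteration.\<close>

definition third_step :: "('a::real_vector \<Rightarrow> 'a) \<Rightarrow> 'a \<Rightarrow> 'a" where
  "third_step w x = (2 / 3) *\<^sub>R x + (1 / 3) *\<^sub>R w x"

section \<open>Affine hyperplane arrangements\<close>

text \<open>Used twice: for the full root system, and for its roots orthogonal to the drift of
  \<open>w\<close>.\<close>

locale affine_arrangement =
  fixes \<Psi> :: "'a::euclidean_space set"
  assumes finite_roots: "finite \<Psi>"
    and zero_not_root: "0 \<notin> \<Psi>"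
    and refl_closed: "\<alpha> \<in> \<Psi> \<Longrightarrow> \<beta> \<in> \<Psi> \<Longrightarrow> refl \<alpha> \<beta> \<in> \<Psi>"
    and integral: "\<alpha> \<in> \<Psi> \<Longrightarrow> \<beta> \<in> \<Psi> \<Longrightarrow> \<beta> \<bullet> coroot \<alpha> \<in> \<int>"
    and reduced: "\<alpha> \<in> \<Psi> \<Longrightarrow> c *\<^sub>R \<alpha> \<in> \<Psi> \<Longrightarrow> c = 1 \<or> c = -1"
begin

definition reg :: "'a \<Rightarrow> bool" where
  "reg x \<longleftrightarrow> (\<forall>\<alpha>\<in>\<Psi>. \<alpha> \<bullet> x \<notin> \<int>)"

text \<open>One strict and one weak inequality turn each fibre into an interval between floors.
  Hence \<open>sep\<close> depends on the floors alone, and the triangle inclusion holds for all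
  points, regular or not.\<close>

definition sep :: "'a \<Rightarrow> 'a \<Rightarrow> ('a \<times> int) set" where
  "sep x y = {(\<alpha>, k). \<alpha> \<in> \<Psi> \<and> \<alpha> \<bullet> x < of_int k \<and> of_int k \<le> \<alpha> \<bullet> y}"

definition dst :: "'a \<Rightarrow> 'a \<Rightarrow> nat" where
  "dst x y = card (sep x y)"

definition eqv :: "'a \<Rightarrow> 'a \<Rightarrow> bool" where
  "eqv x y \<longleftrightarrow> (\<forall>\<alpha>\<in>\<Psi>. \<lfloor>\<alpha> \<bullet> x\<rfloor> = \<lfloor>\<alpha> \<bullet> y\<rfloor>)"

lemma root_nonzero: "\<alpha> \<in> \<Psi> \<Longrightarrow> \<alpha> \<noteq> 0"
  using zero_not_root by auto

lemma uminus_root: "\<alpha> \<in> \<Psi> \<Longrightarrow> - \<alpha> \<in> \<Psi>"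
proof -
  assume "\<alpha> \<in> \<Psi>"
  moreover have "refl \<alpha> \<alpha> = - \<alpha>"
    using root_nonzero[OF \<open>\<alpha> \<in> \<Psi>\<close>] by (simp add: refl_def coroot_def scaleR_2)
  ultimately show ?thesis using refl_closed by metis
qed

lemma sep_eq_Sigma: "sep x y = (SIGMA \<alpha>:\<Psi>. {\<lfloor>\<alpha> \<bullet> x\<rfloor><..\<lfloor>\<alpha> \<bullet> y\<rfloor>})"
  by (auto simp: sep_def le_floor_iff floor_less_iff)

lemma finite_sep [simp]: "finite (sep x y)"
  by (simp add: sep_eq_Sigma finite_roots)

lemma sep_cong: "eqv x x' \<Longrightarrow> eqv y y' \<Longrightarrow> sep x y = sep x' y'"
  by (auto simp: sep_eq_Sigma eqv_def)

lemma dst_cong: "eqv x x' \<Longrightarrow> eqv y y' \<Longrightarrow> dst x y = dst x' y'"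
  using sep_cong by (simp add: dst_def)

lemma eqv_refl [simp]: "eqv x x" and eqv_sym: "eqv x y \<Longrightarrow> eqv y x"
  and eqv_trans [trans]: "eqv x y \<Longrightarrow> eqv y z \<Longrightarrow> eqv x z"
  by (auto simp: eqv_def)

lemma sep_triangle: "sep x z \<subseteq> sep x y \<union> sep y z"
  by (auto simp: sep_def)

lemma dst_triangle: "dst x z \<le> dst x y + dst y z"
  unfolding dst_def
  by (rule order_trans[OF card_mono[OF _ sep_triangle] card_Un_le]) simp

lemma dst_self [simp]: "dst x x = 0"
  by (simp add: dst_def sep_eq_Sigma)

lemma reg_less_iff: "reg x \<Longrightarrow> \<alpha> \<in> \<Psi> \<Longrightarrow> of_int k \<le> \<alpha> \<bullet> x \<longleftrightarrow> of_int k < \<alpha> \<bullet> x"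
  unfolding reg_def by (metis Ints_of_int less_eq_real_def)

text \<open>The hypothesis bounds the floors in one direction only; the other bound comes from -
  \<alpha>, since negation reverses the floors of non-integers.\<close>

lemma eqv_if_sep_empty:
  assumes "reg x" "reg y" "sep x y = {}"
  shows "eqv x y"
  unfolding eqv_def
proof
  fix \<alpha> assume a: "\<alpha> \<in> \<Psi>"
  have le: "\<lfloor>\<beta> \<bullet> y\<rfloor> \<le> \<lfloor>\<beta> \<bullet> x\<rfloor>" if "\<beta> \<in> \<Psi>" for \<beta>
    using assms(3) that unfolding sep_eq_Sigma by (auto simp: Sigma_empty_iff)
  from le[OF a] le[OF uminus_root[OF a]] assms(1,2) a
  show "\<lfloor>\<alpha> \<bullet> x\<rfloor> = \<lfloor>\<alpha> \<bullet> y\<rfloor>" by (simp add: reg_def floor_uminus)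
qed

text \<open>For each root it suffices to control the nearest integers strictly above and strictly
  below its value at \<open>p\<close>, so only finitely many open half-spaces are
  intersected.\<close>

lemma locally_finite:
  obtains e where "e > 0"
    "\<And>z \<beta> l. z \<in> ball p e \<Longrightarrow> \<beta> \<in> \<Psi> \<Longrightarrow> \<beta> \<bullet> p < of_int l \<Longrightarrow> \<beta> \<bullet> z < of_int l"
    "\<And>z \<beta> l. z \<in> ball p e \<Longrightarrow> \<beta> \<in> \<Psi> \<Longrightarrow> of_int l < \<beta> \<bullet> p \<Longrightarrow> of_int l < \<beta> \<bullet> z"
proof -
  define N where "N = (\<Inter>\<beta>\<in>\<Psi>. {z. \<beta> \<bullet> z < of_int (\<lfloor>\<beta> \<bullet> p\<rfloor> + 1)} \<inter> {z. of_int (\<lceil>\<beta> \<bullet> p\<rceil> - 1) < \<beta> \<bullet> z})"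
  have "open N"
    unfolding N_def using finite_roots
    by (intro open_INT ballI open_Int open_halfspace_lt open_halfspace_gt)
  moreover have "p \<in> N" unfolding N_def by auto linarith
  ultimately obtain e where e: "e > 0" "ball p e \<subseteq> N"
    by (meson open_contains_ball)
  show thesis
  proof (rule that[OF e(1)])
    fix z \<beta> l assume z: "z \<in> ball p e" "\<beta> \<in> \<Psi>"
    then have zN: "\<beta> \<bullet> z < of_int (\<lfloor>\<beta> \<bullet> p\<rfloor> + 1)" "of_int (\<lceil>\<beta> \<bullet> p\<rceil> - 1) < \<beta> \<bullet> z"
      using e(2) unfolding N_def by auto
    show "\<beta> \<bullet> z < of_int l" if "\<beta> \<bullet> p < of_int l"
    proof -
      have "\<lfloor>\<beta> \<bullet> p\<rfloor> + 1 \<le> l" using that floor_less_iff[of "\<beta> \<bullet> p" l] by linarith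
      with zN(1) show ?thesis by linarith
    qed
    show "of_int l < \<beta> \<bullet> z" if "of_int l < \<beta> \<bullet> p"
    proof -
      have "l \<le> \<lceil>\<beta> \<bullet> p\<rceil> - 1" using that less_ceiling_iff[of l "\<beta> \<bullet> p"] by linarith
      with zN(2) show ?thesis by linarith
    qed
  qed
qed

section \<open>Alcoves as open convex cells, and crossing a single hyperplane\<close>

definition cell :: "'a \<Rightarrow> 'a set" where
  "cell x = {z. \<forall>\<alpha>\<in>\<Psi>. of_int \<lfloor>\<alpha> \<bullet> x\<rfloor> < \<alpha> \<bullet> z \<and> \<alpha> \<bullet> z < of_int \<lfloor>\<alpha> \<bullet> x\<rfloor> + 1}"

lemma cell_eq_INT:
  "cell x = (\<Inter>\<alpha>\<in>\<Psi>. {z. \<alpha> \<bullet> z < of_int \<lfloor>\<alpha> \<bullet> x\<rfloor> + 1} \<inter> {z. \<alpha> \<bullet> z > of_int \<lfloor>\<alpha> \<bullet> x\<rfloor>})"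
  unfolding cell_def by auto

lemma open_cell: "open (cell x)"
  unfolding cell_eq_INT using finite_roots
  by (intro open_INT ballI open_Int open_halfspace_lt open_halfspace_gt)

lemma convex_cell: "convex (cell x)"
  unfolding cell_eq_INT by (intro convex_INT convex_Int convex_halfspace_lt convex_halfspace_gt)

lemma cell_iff: "z \<in> cell x \<longleftrightarrow> reg z \<and> eqv x z"
proof -
  have "of_int n < a \<and> a < of_int n + 1 \<longleftrightarrow> a \<notin> \<int> \<and> n = \<lfloor>a\<rfloor>" for a :: real and n
  proof
    assume a: "of_int n < a \<and> a < of_int n + 1"
    then have "n = \<lfloor>a\<rfloor>" by linarith
    moreover have "a \<notin> \<int>"
      using a \<open>n = \<lfloor>a\<rfloor>\<close> by (metis Ints_cases floor_of_int less_irrefl)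
    ultimately show "a \<notin> \<int> \<and> n = \<lfloor>a\<rfloor>" by simp
  next
    assume a: "a \<notin> \<int> \<and> n = \<lfloor>a\<rfloor>"
    then have "of_int \<lfloor>a\<rfloor> \<noteq> a" by (metis Ints_of_int)
    then show "of_int n < a \<and> a < of_int n + 1" using a by linarith
  qed
  then show ?thesis unfolding cell_def reg_def eqv_def by auto
qed

text \<open>Perturbing \<open>x\<close> inside its cell makes the segment to \<open>y\<close> meet
  the separating hyperplanes at distinct times. Just before the first meeting point
  \<open>p\<close>, the point \<open>z\<close> is still in the cell of \<open>x\<close>; its mirror
  image is equally close to \<open>p\<close>, so both lie in \<open>U\<close> and nothing else lies
  between them.\<close>

lemma crossing:
  assumes U: "open U" "convex U" "x \<in> U" "y \<in> U" and reg: "reg x" "reg y"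
    and ne: "sep x y \<noteq> {}"
  obtains \<alpha> k z where "(\<alpha>, k) \<in> sep x y" "z \<in> U" "reg z" "eqv x z"
    "affrefl \<alpha> k z \<in> U" "sep z (affrefl \<alpha> k z) = {(\<alpha>, k)}"
proof -
  define I where "I = {(h, h'). h \<in> sep x y \<and> h' \<in> sep x y \<and> h \<noteq> h'}"
  \<comment> \<open>For \<open>x'\<close> near \<open>x\<close>, the equation
    \<open>\<gamma> i \<bullet> x' = c i\<close> says that the segment from \<open>x'\<close> to
    \<open>y\<close> meets the two hyperplanes of \<open>i\<close> at the same time.\<close>
  define \<gamma> :: "('a \<times> int) \<times> ('a \<times> int) \<Rightarrow> 'a"
    where "\<gamma> = (\<lambda>((\<alpha>, k), (\<beta>, l)). (\<beta> \<bullet> y - of_int l) *\<^sub>R \<alpha> - (\<alpha> \<bullet> y - of_int k) *\<^sub>R \<beta>)"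
  define c :: "('a \<times> int) \<times> ('a \<times> int) \<Rightarrow> real"
    where "c = (\<lambda>((\<alpha>, k), (\<beta>, l)). (\<beta> \<bullet> y - of_int l) * of_int k - (\<alpha> \<bullet> y - of_int k) * of_int l)"
  have "finite I" by (rule finite_subset[of _ "sep x y \<times> sep x y"]) (auto simp: I_def)
  then have "countable I" by (rule countable_finite)
  have \<gamma>: "\<gamma> i \<noteq> 0" if "i \<in> I" for i
  proof
    assume g0: "\<gamma> i = 0"
    obtain \<alpha> k \<beta> l where i: "i = ((\<alpha>, k), (\<beta>, l))" by (metis surj_pair)
    have h: "(\<alpha>, k) \<in> sep x y" "(\<beta>, l) \<in> sep x y" "(\<alpha>, k) \<noteq> (\<beta>, l)"
      using that i by (auto simp: I_def)
    then have pos: "\<beta> \<bullet> y - of_int l > 0" "\<alpha> \<bullet> y - of_int k > 0" and r: "\<alpha> \<in> \<Psi>" "\<beta> \<in> \<Psi>"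
      using reg_less_iff[OF reg(2)] by (auto simp: sep_def)
    from g0 have eq: "(\<beta> \<bullet> y - of_int l) *\<^sub>R \<alpha> = (\<alpha> \<bullet> y - of_int k) *\<^sub>R \<beta>"
      by (simp add: \<gamma>_def i)
    define q where "q = (\<alpha> \<bullet> y - of_int k) / (\<beta> \<bullet> y - of_int l)"
    have "\<alpha> = q *\<^sub>R \<beta>"
      using arg_cong[OF eq, of "\<lambda>v. (1 / (\<beta> \<bullet> y - of_int l)) *\<^sub>R v"] pos(1)
      by (simp add: q_def)
    moreover have "q > 0" using pos by (simp add: q_def)
    ultimately have "\<alpha> = \<beta>" using reduced[OF r(2), of q] r(1) by auto
    with eq have "(of_int k - of_int l) *\<^sub>R \<alpha> = (0::'a)" by (simp add: algebra_simps)
    then have "k = l" using root_nonzero[OF r(1)] by simp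
    with \<open>\<alpha> = \<beta>\<close> h(3) show False by simp
  qed
  obtain x' where x': "x' \<in> cell x \<inter> U" and gen: "\<And>i. i \<in> I \<Longrightarrow> \<gamma> i \<bullet> x' \<noteq> c i"
    using generic_point[of I \<gamma> "cell x \<inter> U" c] \<open>countable I\<close> \<gamma> open_cell U reg cell_iff[of x x]
    by (metis IntI eqv_refl empty_iff open_Int)
  have "eqv x x'" "reg x'" using x' cell_iff by auto
  have sepx': "sep x' y = sep x y" using sep_cong[OF \<open>eqv x x'\<close>, of y y] by simp
  define tm :: "'a \<times> int \<Rightarrow> real"
    where "tm = (\<lambda>(\<alpha>, k). (of_int k - \<alpha> \<bullet> x') / (\<alpha> \<bullet> y - \<alpha> \<bullet> x'))"
  define h where "h = arg_min_on tm (sep x y)"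
  have h: "h \<in> sep x y" using ne by (simp add: h_def arg_min_if_finite)
  have hmin: "tm h \<le> tm h'" if "h' \<in> sep x y" for h'
    using arg_min_least[OF finite_sep ne that, of tm] by (simp add: h_def)
  obtain \<alpha> k where hk: "h = (\<alpha>, k)" by (metis surj_pair)
  have strict: "\<beta> \<in> \<Psi>" "\<beta> \<bullet> x' < of_int l" "of_int l < \<beta> \<bullet> y" if "(\<beta>, l) \<in> sep x y" for \<beta> l
    using that reg_less_iff[OF reg(2)] unfolding sepx'[symmetric] by (auto simp: sep_def)
  define t where "t = tm h"
  note hs = strict[OF h[unfolded hk]]
  have t: "0 < t" "t < 1" using hs by (auto simp: t_def tm_def hk)
  define P where "P = (\<lambda>s. x' + s *\<^sub>R (y - x'))"
  have inP: "\<beta> \<bullet> P s = \<beta> \<bullet> x' + s * (\<beta> \<bullet> y - \<beta> \<bullet> x')" for \<beta> s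
    by (simp add: P_def inner_add_right inner_diff_right)
  \<comment> \<open>A half-space entered before time \<open>t\<close> would belong to
    \<open>sep x y\<close> and contradict the minimality of \<open>t\<close>.\<close>
  have before: "\<beta> \<bullet> P s < of_int l" if "\<beta> \<in> \<Psi>" "\<beta> \<bullet> x' < of_int l" "0 \<le> s" "s < t" for \<beta> l s
  proof (rule ccontr)
    assume "\<not> ?thesis"
    then have ge: "of_int l \<le> \<beta> \<bullet> x' + s * (\<beta> \<bullet> y - \<beta> \<bullet> x')" by (simp add: inP)
    then have "0 < s * (\<beta> \<bullet> y - \<beta> \<bullet> x')" using that by linarith
    then have pos: "\<beta> \<bullet> y - \<beta> \<bullet> x' > 0" using that(3) zero_less_mult_pos by (metis less_eq_real_def mult_zero_left less_irrefl)
    have "s * (\<beta> \<bullet> y - \<beta> \<bullet> x') \<le> 1 * (\<beta> \<bullet> y - \<beta> \<bullet> x')"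
      using that t pos by (intro mult_right_mono) auto
    then have "(\<beta>, l) \<in> sep x y" unfolding sepx'[symmetric] using that ge by (auto simp: sep_def)
    from hmin[OF this] have "t \<le> (of_int l - \<beta> \<bullet> x') / (\<beta> \<bullet> y - \<beta> \<bullet> x')"
      by (simp add: t_def tm_def)
    also have "\<dots> \<le> s" using ge pos by (simp add: field_simps)
    finally show False using that by simp
  qed
  define p where "p = P t"
  have pU: "p \<in> U"
  proof -
    have "p = (1 - t) *\<^sub>R x' + t *\<^sub>R y" by (simp add: p_def P_def algebra_simps)
    then show ?thesis using convexD_alt[OF U(2), of x' y t] x' U t by auto
  qed
  have ap: "\<alpha> \<bullet> p = of_int k" using hs by (simp add: p_def inP t_def tm_def hk)
  \<comment> \<open>Genericity: a second half-space entered at time \<open>t\<close> would give two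
    coinciding crossing times.\<close>
  have only1: "(\<beta>, l) = h" if "\<beta> \<in> \<Psi>" "\<beta> \<bullet> p = of_int l" "\<beta> \<bullet> x' < of_int l" for \<beta> l
  proof (rule ccontr)
    assume neq: "(\<beta>, l) \<noteq> h"
    have eq: "of_int l = \<beta> \<bullet> x' + t * (\<beta> \<bullet> y - \<beta> \<bullet> x')" using that by (simp add: p_def inP)
    then have "0 < t * (\<beta> \<bullet> y - \<beta> \<bullet> x')" using that by linarith
    then have pos: "\<beta> \<bullet> y - \<beta> \<bullet> x' > 0" using t(1) zero_less_mult_pos by blast
    have "t * (\<beta> \<bullet> y - \<beta> \<bullet> x') \<le> 1 * (\<beta> \<bullet> y - \<beta> \<bullet> x')"
      using t pos by (intro mult_right_mono) auto
    then have hl: "(\<beta>, l) \<in> sep x y" unfolding sepx'[symmetric] using that eq by (auto simp: sep_def)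
    have "((\<alpha>, k), (\<beta>, l)) \<in> I" using hl neq h hk by (auto simp: I_def)
    from gen[OF this] have "(\<beta> \<bullet> y - of_int l) * (\<alpha> \<bullet> x' - of_int k) \<noteq> (\<alpha> \<bullet> y - of_int k) * (\<beta> \<bullet> x' - of_int l)"
      by (simp add: \<gamma>_def c_def inner_diff_left algebra_simps)
    moreover have eq2: "of_int k = \<alpha> \<bullet> x' + t * (\<alpha> \<bullet> y - \<alpha> \<bullet> x')" using ap by (simp add: p_def inP)
    ultimately show False unfolding eq eq2 by (simp add: algebra_simps)
  qed
  have only: "(\<beta>, l) = h \<or> (- \<beta>, - l) = h" if b: "\<beta> \<in> \<Psi>" "\<beta> \<bullet> p = of_int l" for \<beta> l
  proof -
    have "\<beta> \<bullet> x' \<noteq> of_int l" using \<open>reg x'\<close> b(1) unfolding reg_def by (metis Ints_of_int)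
    then consider "\<beta> \<bullet> x' < of_int l" | "(- \<beta>) \<bullet> x' < of_int (- l)" by fastforce
    then show ?thesis
      using only1[OF b] only1[OF uminus_root[OF b(1)], of "- l"] b(2) by cases auto
  qed
  obtain e where e: "e > 0"
    "\<And>z \<beta> l. z \<in> ball p e \<Longrightarrow> \<beta> \<in> \<Psi> \<Longrightarrow> \<beta> \<bullet> p < of_int l \<Longrightarrow> \<beta> \<bullet> z < of_int l"
    "\<And>z \<beta> l. z \<in> ball p e \<Longrightarrow> \<beta> \<in> \<Psi> \<Longrightarrow> of_int l < \<beta> \<bullet> p \<Longrightarrow> of_int l < \<beta> \<bullet> z"
    using locally_finite[of p] by blast
  obtain e' where e': "e' > 0" "ball p e' \<subseteq> U" using pU U(1) by (meson open_contains_ball)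
  have "isCont P t" unfolding P_def by (intro continuous_intros)
  then obtain d where d: "d > 0" "\<And>s. dist s t < d \<Longrightarrow> dist (P s) (P t) < min e e'"
    using e(1) e'(1) unfolding continuous_at_eps_delta by (metis min_less_iff_conj)
  \<comment> \<open>Slightly earlier than \<open>t\<close>: \<open>d / 2\<close> stays within the
    continuity radius, and the maximum with 0 keeps \<open>z\<close> on the segment.\<close>
  define s where "s = max 0 (t - d / 2)"
  have s: "0 \<le> s" "s < t" "dist s t < d" using t d by (auto simp: s_def dist_real_def)
  define z where "z = P s"
  have dz: "dist p z < min e e'" using d(2)[OF s(3)] by (simp add: z_def p_def dist_commute)
  have anz: "\<alpha> \<noteq> 0" using root_nonzero[OF hs(1)] .
  define z' where "z' = affrefl \<alpha> k z"
  have dz': "dist p z' < min e e'"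
    using dz dist_affrefl[OF anz, of k p z] affrefl_eq_self[OF ap] by (simp add: z'_def)
  have zb: "\<beta> \<bullet> z < of_int l" if "\<beta> \<in> \<Psi>" "\<beta> \<bullet> x' < of_int l" for \<beta> l
    using before[OF that s(1,2)] by (simp add: z_def)
  have za: "of_int l < \<beta> \<bullet> z" if "\<beta> \<in> \<Psi>" "of_int l < \<beta> \<bullet> x'" for \<beta> l
    using zb[OF uminus_root[OF that(1)], of "- l"] that(2) by simp
  have tri: "\<beta> \<bullet> x' < of_int l \<or> of_int l < \<beta> \<bullet> x'" if "\<beta> \<in> \<Psi>" for \<beta> and l :: int
    using \<open>reg x'\<close> that unfolding reg_def by (metis Ints_of_int linorder_neqE_linordered_idom)
  have regz: "reg z" unfolding reg_def
  proof (intro ballI notI)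
    fix \<beta> assume b: "\<beta> \<in> \<Psi>" "\<beta> \<bullet> z \<in> \<int>"
    then obtain l :: int where l: "\<beta> \<bullet> z = of_int l" by (auto elim: Ints_cases)
    from tri[OF b(1), of l] zb[OF b(1), of l] za[OF b(1), of l] l show False by auto
  qed
  have "\<lfloor>\<beta> \<bullet> x'\<rfloor> = \<lfloor>\<beta> \<bullet> z\<rfloor>" if b: "\<beta> \<in> \<Psi>" for \<beta>
  proof -
    have "\<beta> \<bullet> x' < of_int (\<lfloor>\<beta> \<bullet> x'\<rfloor> + 1)" by simp
    from zb[OF b this] have 1: "\<beta> \<bullet> z < of_int (\<lfloor>\<beta> \<bullet> x'\<rfloor> + 1)" .
    have "of_int \<lfloor>\<beta> \<bullet> x'\<rfloor> < \<beta> \<bullet> x'" using reg_less_iff[OF \<open>reg x'\<close> b, of "\<lfloor>\<beta> \<bullet> x'\<rfloor>"] by linarith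
    from za[OF b this] 1 show ?thesis by linarith
  qed
  then have "eqv x z" using \<open>eqv x x'\<close> by (simp add: eqv_def)
  have az: "\<alpha> \<bullet> z < of_int k" using zb hs by blast
  have "sep z z' = {(\<alpha>, k)}"
  proof (intro equalityI subsetI)
    fix h' assume h': "h' \<in> sep z z'"
    obtain \<beta> l where h'l: "h' = (\<beta>, l)" by (metis surj_pair)
    have b: "\<beta> \<in> \<Psi>" "\<beta> \<bullet> z < of_int l" "of_int l \<le> \<beta> \<bullet> z'" using h' h'l by (auto simp: sep_def)
    \<comment> \<open>Hyperplanes that miss \<open>p\<close> also miss a neighbourhood containing
      \<open>z\<close> and \<open>z'\<close>, so one between these two points passes through
      \<open>p\<close>.\<close>
    have "\<beta> \<bullet> p = of_int l"
      using e(2)[of z' \<beta> l] e(3)[of z \<beta> l] b dz dz' by (force simp: mem_ball)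
    from only[OF b(1) this] have "h' = h \<or> (- \<beta>, - l) = (\<alpha>, k)" using h'l hk by auto
    then show "h' \<in> {(\<alpha>, k)}" using hk b az by auto
  next
    fix h' assume "h' \<in> {(\<alpha>, k)}"
    then show "h' \<in> sep z z'" using hs az by (simp add: sep_def z'_def inner_affrefl[OF anz])
  qed
  moreover have "z \<in> U" "z' \<in> U" using e'(2) dz dz' by (auto simp: mem_ball)
  ultimately show thesis
    using that[of \<alpha> k z] h hk regz \<open>eqv x z\<close> by (simp add: z'_def)
qed

text \<open>The only danger is that the step to \<open>x'\<close> leaves a half-space containing
  \<open>y\<close>. Its reversal would then be the entered half-space (\<alpha>, k), which contains
  \<open>y\<close> in its interior.\<close>

lemma sep_after_crossing:
  assumes "reg x" "reg y" "(\<alpha>, k) \<in> sep x y" "sep x x' = {(\<alpha>, k)}"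
  shows "sep x' y = sep x y - {(\<alpha>, k)}"
proof (intro equalityI subsetI)
  fix h assume hh: "h \<in> sep x' y"
  obtain \<beta> l where h: "h = (\<beta>, l)" by (metis surj_pair)
  have b: "\<beta> \<in> \<Psi>" "\<beta> \<bullet> x' < of_int l" "of_int l \<le> \<beta> \<bullet> y" using hh h by (auto simp: sep_def)
  have "(\<alpha>, k) \<in> sep x x'" using assms by simp
  then have a: "of_int k \<le> \<alpha> \<bullet> x'" by (simp add: sep_def)
  have "\<beta> \<bullet> x < of_int l"
  proof (rule ccontr)
    assume "\<not> ?thesis"
    then have "of_int l < \<beta> \<bullet> x" using reg_less_iff[OF assms(1) b(1), of l] by simp
    then have "(- \<beta>, - l) \<in> sep x x'" using b uminus_root by (simp add: sep_def)
    then have "\<beta> = - \<alpha>" "l = - k" using assms(4) by auto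
    then have "\<alpha> \<bullet> y \<le> of_int k" using b by simp
    moreover have "of_int k < \<alpha> \<bullet> y"
      using assms(3) reg_less_iff[OF assms(2), of \<alpha> k] by (auto simp: sep_def)
    ultimately show False by simp
  qed
  then show "h \<in> sep x y - {(\<alpha>, k)}" using b h a by (auto simp: sep_def)
next
  fix h assume hh: "h \<in> sep x y - {(\<alpha>, k)}"
  obtain \<beta> l where h: "h = (\<beta>, l)" by (metis surj_pair)
  have "(\<beta>, l) \<notin> sep x x'" using hh h assms(4) by auto
  then show "h \<in> sep x' y" using hh h by (auto simp: sep_def)
qed

section \<open>Automorphisms and the reflection group\<close>

text \<open>The integrality of the translation part makes these isometries permute the hyperplanes.
  Unlike \<open>RG\<close>, the notion covers the whole extended group, in particular
  \<open>w\<close> itself.\<close>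

definition aut :: "('a \<Rightarrow> 'a) \<Rightarrow> bool" where
  "aut g \<longleftrightarrow> (\<exists>L p. orthogonal_transformation L \<and> L ` \<Psi> = \<Psi> \<and>
     (\<forall>\<alpha>\<in>\<Psi>. \<alpha> \<bullet> p \<in> \<int>) \<and> g = (\<lambda>x. p + L x))"

lemma aut_id: "aut id"
proof -
  have "orthogonal_transformation (id :: 'a \<Rightarrow> 'a)"
    by (rule orthogonal_transformation_id[folded id_def])
  moreover have "id = (\<lambda>x::'a. 0 + id x)" by (rule ext) simp
  moreover have "id ` \<Psi> = \<Psi>" "\<forall>\<alpha>\<in>\<Psi>. \<alpha> \<bullet> 0 \<in> \<int>" by simp_all
  ultimately show ?thesis unfolding aut_def by blast
qed

lemma aut_comp:
  assumes "aut g" "aut h"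
  shows "aut (g \<circ> h)"
proof -
  obtain L p where g: "orthogonal_transformation L" "L ` \<Psi> = \<Psi>" "\<forall>\<alpha>\<in>\<Psi>. \<alpha> \<bullet> p \<in> \<int>" "g = (\<lambda>x. p + L x)"
    using assms(1) by (auto simp: aut_def)
  obtain M q where h: "orthogonal_transformation M" "M ` \<Psi> = \<Psi>" "\<forall>\<alpha>\<in>\<Psi>. \<alpha> \<bullet> q \<in> \<int>" "h = (\<lambda>x. q + M x)"
    using assms(2) by (auto simp: aut_def)
  have "\<alpha> \<bullet> (p + L q) \<in> \<int>" if "\<alpha> \<in> \<Psi>" for \<alpha>
  proof -
    have "\<alpha> \<in> L ` \<Psi>" using that g(2) by simp
    then obtain \<beta> where "\<beta> \<in> \<Psi>" "\<alpha> = L \<beta>" by blast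
    then have "\<alpha> \<bullet> L q = \<beta> \<bullet> q" using g(1) by (simp add: orthogonal_transformation_def)
    then show ?thesis using g(3) h(3) that \<open>\<beta> \<in> \<Psi>\<close> by (simp add: inner_add_right)
  qed
  moreover have "orthogonal_transformation (L \<circ> M)"
    using g(1) h(1) by (rule orthogonal_transformation_compose)
  moreover have "(L \<circ> M) ` \<Psi> = \<Psi>" using g(2) h(2) by (simp only: image_comp[symmetric])
  moreover have "g \<circ> h = (\<lambda>x. (p + L q) + (L \<circ> M) x)"
    using g(1) by (intro ext) (simp add: g(4) h(4) orthogonal_transformation_def linear_add)
  ultimately show ?thesis
    unfolding aut_def by (intro exI[of _ "L \<circ> M"] exI[of _ "p + L q"]) simp
qed

lemma aut_bij:
  assumes "aut g"
  shows "bij g"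
proof -
  obtain L p where L: "orthogonal_transformation L" and g: "g = (\<lambda>x. p + L x)"
    using assms by (auto simp: aut_def)
  have "bij L" using L by (rule orthogonal_transformation_bij)
  moreover have "bij ((+) p)" by (rule bij_betw_byWitness[of _ "\<lambda>x. x - p"]) auto
  ultimately have "bij ((+) p \<circ> L)" by (rule bij_comp)
  then show ?thesis by (simp add: g comp_def)
qed

lemma aut_inv:
  assumes "aut g"
  shows "aut (inv g)"
proof -
  obtain L p where g: "orthogonal_transformation L" "L ` \<Psi> = \<Psi>" "\<forall>\<alpha>\<in>\<Psi>. \<alpha> \<bullet> p \<in> \<int>" "g = (\<lambda>x. p + L x)"
    using assms by (auto simp: aut_def)
  have bij: "bij L" using g(1) by (rule orthogonal_transformation_bij)
  have o: "orthogonal_transformation (inv L)" using g(1) by (rule orthogonal_transformation_inv)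
  have lin: "linear (inv L)" using o by (simp add: orthogonal_transformation_def)
  have "inv g = (\<lambda>x. - inv L p + inv L x)"
  proof (rule inv_equality)
    show "- inv L p + inv L (g x) = x" for x
      using bij lin by (simp add: g(4) linear_add bij_is_inj)
    show "g (- inv L p + inv L y) = y" for y
      using bij g(1) by (simp add: g(4) orthogonal_transformation_def linear_add linear_neg linear_diff bij_is_surj surj_f_inv_f)
  qed
  moreover have "inv L ` \<Psi> = \<Psi>" using g(2) bij by (metis bij_is_inj image_inv_f_f)
  moreover have "\<alpha> \<bullet> (- inv L p) \<in> \<int>" if "\<alpha> \<in> \<Psi>" for \<alpha>
  proof -
    have "\<alpha> \<bullet> inv L p = L \<alpha> \<bullet> p"
      using g(1) bij by (metis bij_is_surj orthogonal_transformation_def surj_f_inv_f)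
    then show ?thesis using that g(2,3) by auto
  qed
  ultimately show ?thesis unfolding aut_def using o by blast
qed

lemma refl_image:
  assumes "\<alpha> \<in> \<Psi>"
  shows "refl \<alpha> ` \<Psi> = \<Psi>"
proof -
  have "refl \<alpha> ` \<Psi> \<subseteq> \<Psi>" using refl_closed assms by blast
  moreover have "inj_on (refl \<alpha>) \<Psi>"
    using orthogonal_transformation_bij[OF orthogonal_transformation_refl[OF root_nonzero[OF assms]]]
    by (meson bij_is_inj inj_on_subset subset_UNIV)
  ultimately show ?thesis using finite_roots by (metis card_image card_subset_eq)
qed

lemma aut_affrefl:
  assumes "\<alpha> \<in> \<Psi>"
  shows "aut (affrefl \<alpha> k)"
proof -
  have o: "orthogonal_transformation (refl \<alpha>)"
    using orthogonal_transformation_refl root_nonzero assms by blast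
  then show ?thesis unfolding aut_def affrefl_eq_refl
    using refl_image[OF assms] integral[OF assms] by (intro exI conjI) auto
qed

lemma affrefl_comp_self: "\<alpha> \<in> \<Psi> \<Longrightarrow> affrefl \<alpha> k \<circ> affrefl \<alpha> k = id"
  using root_nonzero by auto

lemma inv_affrefl: "\<alpha> \<in> \<Psi> \<Longrightarrow> inv (affrefl \<alpha> k) = affrefl \<alpha> k"
  using root_nonzero by (intro inv_equality) auto

text \<open>\<open>g\<close> maps the half-space \<open>\<alpha> \<bullet> x > k\<close> to \<open>L \<alpha> \<bullet> x > k + m \<alpha>\<close>.\<close>
definition induces :: "('a \<Rightarrow> 'a) \<Rightarrow> ('a \<Rightarrow> 'a) \<Rightarrow> ('a \<Rightarrow> int) \<Rightarrow> bool" where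
  "induces g L m \<longleftrightarrow> inj L \<and> L ` \<Psi> = \<Psi> \<and>
     (\<forall>\<alpha>\<in>\<Psi>. \<forall>x. L \<alpha> \<bullet> g x = \<alpha> \<bullet> x + of_int (m \<alpha>)) \<and>
     (\<forall>\<alpha>\<in>\<Psi>. \<forall>k x. affrefl (L \<alpha>) (k + m \<alpha>) (g x) = g (affrefl \<alpha> k x))"

lemma aut_induces:
  assumes "aut g"
  obtains L m where "induces g L m"
proof -
  obtain L p where g: "orthogonal_transformation L" "L ` \<Psi> = \<Psi>" "\<forall>\<alpha>\<in>\<Psi>. \<alpha> \<bullet> p \<in> \<int>" "g = (\<lambda>x. p + L x)"
    using assms by (auto simp: aut_def)
  define m where "m \<alpha> = \<lfloor>L \<alpha> \<bullet> p\<rfloor>" for \<alpha>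
  have m: "L \<alpha> \<bullet> p = of_int (m \<alpha>)" if "\<alpha> \<in> \<Psi>" for \<alpha>
    using g(2,3) that unfolding m_def by (metis Ints_cases floor_of_int image_eqI)
  have inner: "L \<alpha> \<bullet> g x = \<alpha> \<bullet> x + of_int (m \<alpha>)" if "\<alpha> \<in> \<Psi>" for \<alpha> x
    using m[OF that] g(1,4) by (simp add: inner_add_right orthogonal_transformation_def)
  have "affrefl (L \<alpha>) (k + m \<alpha>) (g x) = g (affrefl \<alpha> k x)" if "\<alpha> \<in> \<Psi>" for \<alpha> k x
  proof -
    have "affrefl (L \<alpha>) (k + m \<alpha>) (g x) = g x - (\<alpha> \<bullet> x - of_int k) *\<^sub>R L (coroot \<alpha>)"
      using inner[OF that] coroot_orthogonal[OF g(1)] by (simp add: affrefl_def)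
    also have "\<dots> = g (affrefl \<alpha> k x)"
      using g(1) by (simp add: g(4) affrefl_def orthogonal_transformation_def linear_diff linear_cmul)
    finally show ?thesis .
  qed
  moreover have "inj L" using g(1) orthogonal_transformation_bij bij_is_inj by blast
  ultimately have "induces g L m" unfolding induces_def using g(2) inner by blast
  then show thesis by (rule that)
qed

lemma
  assumes "induces g L m"
  shows induces_root: "\<alpha> \<in> \<Psi> \<Longrightarrow> L \<alpha> \<in> \<Psi>"
    and induces_inner: "\<alpha> \<in> \<Psi> \<Longrightarrow> L \<alpha> \<bullet> g x = \<alpha> \<bullet> x + of_int (m \<alpha>)"
    and induces_affrefl: "\<alpha> \<in> \<Psi> \<Longrightarrow> affrefl (L \<alpha>) (k + m \<alpha>) (g x) = g (affrefl \<alpha> k x)"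
  using assms by (auto simp: induces_def)

lemma induces_rootE:
  assumes "induces g L m" "\<beta> \<in> \<Psi>"
  obtains \<alpha> where "\<alpha> \<in> \<Psi>" "\<beta> = L \<alpha>"
proof -
  have "\<beta> \<in> L ` \<Psi>" using assms by (simp add: induces_def)
  then show thesis using that by blast
qed

lemma induces_sep:
  assumes "induces g L m"
  shows "sep (g x) (g y) = (\<lambda>(\<alpha>, k). (L \<alpha>, k + m \<alpha>)) ` sep x y" (is "_ = ?R")
proof (intro equalityI subsetI)
  fix h assume hh: "h \<in> sep (g x) (g y)"
  obtain \<beta> l where h: "h = (\<beta>, l)" by (metis surj_pair)
  have b: "\<beta> \<in> \<Psi>" "\<beta> \<bullet> g x < of_int l" "of_int l \<le> \<beta> \<bullet> g y" using hh h by (auto simp: sep_def)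
  obtain \<alpha> where a: "\<alpha> \<in> \<Psi>" "\<beta> = L \<alpha>" using induces_rootE[OF assms b(1)] .
  have "(\<alpha>, l - m \<alpha>) \<in> sep x y"
    using b a induces_inner[OF assms a(1)] by (auto simp: sep_def)
  then show "h \<in> ?R" using h a by (auto intro!: rev_image_eqI)
next
  fix h assume "h \<in> ?R"
  then show "h \<in> sep (g x) (g y)"
    using induces_root[OF assms] induces_inner[OF assms] by (auto simp: sep_def)
qed

lemma dst_aut:
  assumes "aut g"
  shows "dst (g x) (g y) = dst x y"
proof -
  obtain L m where L: "induces g L m" using aut_induces[OF assms] .
  have "inj L" using L by (simp add: induces_def)
  then have "inj_on (\<lambda>(\<alpha>, k). (L \<alpha>, k + m \<alpha>)) (sep x y)"
    by (intro inj_onI) (clarsimp simp: inj_eq)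
  then show ?thesis unfolding dst_def induces_sep[OF L] by (rule card_image)
qed

lemma eqv_autI:
  assumes "aut g" "eqv x y"
  shows "eqv (g x) (g y)"
  unfolding eqv_def
proof
  fix \<beta> assume "\<beta> \<in> \<Psi>"
  obtain L m where L: "induces g L m" using aut_induces[OF assms(1)] .
  obtain \<alpha> where "\<alpha> \<in> \<Psi>" "\<beta> = L \<alpha>" using induces_rootE[OF L \<open>\<beta> \<in> \<Psi>\<close>] .
  then show "\<lfloor>\<beta> \<bullet> g x\<rfloor> = \<lfloor>\<beta> \<bullet> g y\<rfloor>" using induces_inner[OF L] assms(2) by (simp add: eqv_def)
qed

lemma reg_aut:
  assumes "aut g" "reg x"
  shows "reg (g x)"
  unfolding reg_def
proof
  fix \<beta> assume "\<beta> \<in> \<Psi>"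
  obtain L m where L: "induces g L m" using aut_induces[OF assms(1)] .
  obtain \<alpha> where a: "\<alpha> \<in> \<Psi>" "\<beta> = L \<alpha>" using induces_rootE[OF L \<open>\<beta> \<in> \<Psi>\<close>] .
  have "\<alpha> \<bullet> x = \<beta> \<bullet> g x - of_int (m \<alpha>)" using a induces_inner[OF L] by simp
  then show "\<beta> \<bullet> g x \<notin> \<int>" using assms(2) a(1) unfolding reg_def by (metis Ints_diff Ints_of_int)
qed

text \<open>Generated by all affine reflections, so that stability under conjugation by
  automorphisms is visible; generation by the walls of one alcove is proved in
  \<open>RG_word\<close>.\<close>

inductive_set RG :: "('a \<Rightarrow> 'a) set" where
  RG_id: "id \<in> RG"
| RG_affrefl: "g \<in> RG \<Longrightarrow> \<alpha> \<in> \<Psi> \<Longrightarrow> affrefl \<alpha> k \<circ> g \<in> RG"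

lemma affrefl_in_RG: "\<alpha> \<in> \<Psi> \<Longrightarrow> affrefl \<alpha> k \<in> RG"
  using RG_affrefl[OF RG_id] by simp

lemma RG_comp: "g \<in> RG \<Longrightarrow> h \<in> RG \<Longrightarrow> g \<circ> h \<in> RG"
  by (induction g rule: RG.induct) (simp_all only: comp_assoc id_comp RG.intros)

lemma RG_aut: "g \<in> RG \<Longrightarrow> aut g"
  by (induction g rule: RG.induct) (simp_all only: aut_id aut_comp aut_affrefl)

lemma RG_inv: "g \<in> RG \<Longrightarrow> inv g \<in> RG"
proof (induction g rule: RG.induct)
  case RG_id
  then show ?case by (metis RG.RG_id inv_id)
next
  case (RG_affrefl g \<alpha> k)
  have "inv (affrefl \<alpha> k \<circ> g) = inv g \<circ> affrefl \<alpha> k"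
    using RG_affrefl aut_affrefl RG_aut aut_bij by (simp add: o_inv_distrib inv_affrefl)
  then show ?case by (metis RG_affrefl.IH RG_affrefl.hyps(2) RG_comp affrefl_in_RG)
qed

lemma conj_affrefl:
  assumes "aut g" "\<alpha> \<in> \<Psi>"
  obtains \<beta> l where "\<beta> \<in> \<Psi>" "affrefl \<beta> l \<circ> g = g \<circ> affrefl \<alpha> k"
    "\<forall>x y. sep x y = {(\<alpha>, k)} \<longrightarrow> sep (g x) (g y) = {(\<beta>, l)}"
proof -
  obtain L m where L: "induces g L m" using aut_induces[OF assms(1)] .
  show thesis
  proof (rule that[of "L \<alpha>" "k + m \<alpha>"])
    show "L \<alpha> \<in> \<Psi>" using induces_root[OF L assms(2)] .
    show "affrefl (L \<alpha>) (k + m \<alpha>) \<circ> g = g \<circ> affrefl \<alpha> k" using induces_affrefl[OF L assms(2)] by auto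
    show "\<forall>x y. sep x y = {(\<alpha>, k)} \<longrightarrow> sep (g x) (g y) = {(L \<alpha>, k + m \<alpha>)}"
      by (simp add: induces_sep[OF L])
  qed
qed

lemma RG_conj:
  assumes "aut g" "z \<in> RG"
  shows "g \<circ> z \<circ> inv g \<in> RG"
  using assms(2)
proof (induction z rule: RG.induct)
  case RG_id
  have "g \<circ> id \<circ> inv g = id" using aut_bij[OF assms(1)] by (metis bij_is_surj comp_id surj_iff)
  then show ?case using RG.RG_id by (simp only:)
next
  case (RG_affrefl z \<alpha> k)
  obtain \<beta> l where b: "\<beta> \<in> \<Psi>" "affrefl \<beta> l \<circ> g = g \<circ> affrefl \<alpha> k"
    by (rule conj_affrefl[OF assms(1) RG_affrefl(2), of k])
  have "g \<circ> (affrefl \<alpha> k \<circ> z) \<circ> inv g = (g \<circ> affrefl \<alpha> k) \<circ> (z \<circ> inv g)"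
    by (simp only: comp_assoc)
  also have "\<dots> = affrefl \<beta> l \<circ> (g \<circ> z \<circ> inv g)"
    by (simp only: b(2)[symmetric] comp_assoc)
  finally have "g \<circ> (affrefl \<alpha> k \<circ> z) \<circ> inv g = affrefl \<beta> l \<circ> (g \<circ> z \<circ> inv g)" .
  then show ?case using RG.RG_affrefl[OF RG_affrefl(3) b(1)] by (simp only:)
qed

section \<open>Galleries and simple transitivity\<close>

text \<open>A wall is recognized as the only hyperplane between \<open>c\<close> and its mirror
  image, which avoids speaking of faces. Its half-space is the one not containing
  \<open>c\<close>.\<close>

definition walls :: "'a \<Rightarrow> ('a \<Rightarrow> 'a) set" where
  "walls c = {affrefl \<alpha> k | \<alpha> k. \<alpha> \<in> \<Psi> \<and> sep c (affrefl \<alpha> k c) = {(\<alpha>, k)}}"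

text \<open>Right multiplication by a wall reflection of the base alcove passes from the alcove of
  \<open>g c\<close> to a neighbour; \<open>G\<close> selects the alcoves allowed.\<close>

definition gallery_step :: "'a \<Rightarrow> (('a \<Rightarrow> 'a) \<Rightarrow> bool) \<Rightarrow> ('a \<Rightarrow> 'a) \<Rightarrow> ('a \<Rightarrow> 'a) \<Rightarrow> bool" where
  "gallery_step c G g g' \<longleftrightarrow> (\<exists>s\<in>walls c. g' = g \<circ> s) \<and> G g \<and> G g'"

lemma walls_in_RG: "s \<in> walls c \<Longrightarrow> s \<in> RG"
  using affrefl_in_RG by (auto simp: walls_def)

lemma walls_self: "s \<in> walls c \<Longrightarrow> s \<circ> s = id"
  by (auto simp: walls_def affrefl_comp_self simp del: comp_apply)

lemma gallery_step_sym: "gallery_step c G g g' \<Longrightarrow> gallery_step c G g' g"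
  unfolding gallery_step_def using walls_self by (metis comp_assoc comp_id)

text \<open>Pulling the crossed hyperplane back along \<open>g\<close> gives a wall of the base
  alcove, so reflecting on the left amounts to a gallery step on the right.\<close>

lemma wall_conj:
  assumes "aut g" "\<alpha> \<in> \<Psi>" "eqv (g c) z" "sep z (affrefl \<alpha> k z) = {(\<alpha>, k)}"
  obtains s where "s \<in> walls c" "g \<circ> s = affrefl \<alpha> k \<circ> g"
proof -
  obtain \<beta> l where b: "\<beta> \<in> \<Psi>" "affrefl \<beta> l \<circ> inv g = inv g \<circ> affrefl \<alpha> k"
    "\<forall>x y. sep x y = {(\<alpha>, k)} \<longrightarrow> sep (inv g x) (inv g y) = {(\<beta>, l)}"
    by (rule conj_affrefl[OF aut_inv[OF assms(1)] assms(2), of k])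
  have bij: "bij g" using aut_bij assms(1) .
  have c: "inv g (g x) = x" "g (inv g x) = x" for x
    using bij by (auto simp: bij_is_inj bij_is_surj surj_f_inv_f)
  have s: "affrefl \<beta> l x = inv g (affrefl \<alpha> k (g x))" for x
    using fun_cong[OF b(2), of "g x"] by (simp add: c)
  have "sep (g c) (affrefl \<alpha> k (g c)) = {(\<alpha>, k)}"
    using sep_cong[OF assms(3) eqv_autI[OF aut_affrefl[OF assms(2)] assms(3)], of k] assms(4) by simp
  from b(3)[rule_format, OF this] have "sep c (affrefl \<beta> l c) = {(\<beta>, l)}" by (simp add: s c)
  then have "affrefl \<beta> l \<in> walls c" using b(1) by (auto simp: walls_def)
  moreover have "g \<circ> affrefl \<beta> l = affrefl \<alpha> k \<circ> g" by (rule ext) (simp add: s c)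
  ultimately show thesis by (rule that)
qed

text \<open>Induction on the distance: each crossing removes one separating half-space. The distance
  inequality available for proving \<open>G\<close> says that the alcoves visited lie on a minimal
  gallery, from which lengths there can be bounded.\<close>

lemma gallery:
  assumes U: "open U" "convex U" and reg: "reg x" "reg y"
    and "x \<in> U" "y \<in> U" and g: "aut g" "eqv (g c) x"
    and G: "\<And>g' z. aut g' \<Longrightarrow> z \<in> U \<Longrightarrow> reg z \<Longrightarrow> eqv (g' c) z \<Longrightarrow>
      dst x z + dst z y \<le> dst x y \<Longrightarrow> G g'"
  shows "\<exists>g'. aut g' \<and> eqv (g' c) y \<and> (gallery_step c G)\<^sup>*\<^sup>* g g'"
  using assms
proof (induction "dst x y" arbitrary: x g)
  case 0
  have "sep x y = {}" using 0(1) by (simp add: dst_def)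
  then have "eqv x y" using eqv_if_sep_empty 0 by blast
  then show ?case using eqv_trans[OF \<open>eqv (g c) x\<close>] \<open>aut g\<close> by blast
next
  case (Suc n)
  have "sep x y \<noteq> {}" using Suc(2) by (auto simp: dst_def)
  then obtain \<alpha> k z where z: "(\<alpha>, k) \<in> sep x y" "z \<in> U" "reg z" "eqv x z"
    "affrefl \<alpha> k z \<in> U" "sep z (affrefl \<alpha> k z) = {(\<alpha>, k)}"
    using crossing[OF U \<open>x \<in> U\<close> \<open>y \<in> U\<close> \<open>reg x\<close> \<open>reg y\<close>] by blast
  define z' where "z' = affrefl \<alpha> k z"
  have a: "\<alpha> \<in> \<Psi>" using z(1) by (simp add: sep_def)
  have sxz: "sep x w = sep z w" "sep w x = sep w z" for w using sep_cong z(4) by auto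
  have "sep z' y = sep x y - {(\<alpha>, k)}"
    using sep_after_crossing[OF z(3) \<open>reg y\<close>, of \<alpha> k z'] z(1,6) unfolding sxz z'_def by simp
  then have d: "dst x y = Suc (dst z' y)"
    using card_Suc_Diff1[OF finite_sep z(1)] by (simp add: dst_def)
  have dxz': "dst x z' = 1" unfolding dst_def sxz using z(6) by (simp add: z'_def)
  have gz: "eqv (g c) z" using eqv_trans[OF \<open>eqv (g c) x\<close> z(4)] .
  obtain s where s: "s \<in> walls c" "g \<circ> s = affrefl \<alpha> k \<circ> g"
    using wall_conj[OF \<open>aut g\<close> a gz z(6)] .
  have z': "reg z'" "z' \<in> U" using z reg_aut[OF aut_affrefl[OF a]] by (auto simp: z'_def)
  have gs: "aut (g \<circ> s)" using \<open>aut g\<close> aut_comp RG_aut walls_in_RG s(1) by blast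
  have gsc: "eqv ((g \<circ> s) c) z'"
    unfolding s(2) z'_def using eqv_autI[OF aut_affrefl[OF a] gz] by simp
  have "\<exists>g'. aut g' \<and> eqv (g' c) y \<and> (gallery_step c G)\<^sup>*\<^sup>* (g \<circ> s) g'"
  proof (rule Suc(1)[OF _ U \<open>reg z'\<close> \<open>reg y\<close> \<open>z' \<in> U\<close> \<open>y \<in> U\<close> gs gsc])
    show "n = dst z' y" using d Suc(2) by simp
    fix g' v assume "aut g'" "v \<in> U" "reg v" "eqv (g' c) v" "dst z' v + dst v y \<le> dst z' y"
    \<comment> \<open>As \<open>z'\<close> is one step along from \<open>x\<close>, a point on a
      minimal gallery from \<open>z'\<close> to \<open>y\<close> is also on one from
      \<open>x\<close> to \<open>y\<close>.\<close>
    moreover have "dst x v \<le> 1 + dst z' v" using dst_triangle[of x v z'] dxz' by simp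
    ultimately show "G g'" using Suc.prems(9)[of g' v] d by simp
  qed
  moreover have "gallery_step c G g (g \<circ> s)"
    unfolding gallery_step_def
  proof (intro conjI bexI[of _ s])
    show "G g" using Suc.prems(9)[of g x] \<open>aut g\<close> \<open>x \<in> U\<close> \<open>reg x\<close> \<open>eqv (g c) x\<close> by simp
    show "G (g \<circ> s)" using Suc.prems(9)[OF gs z'(2,1) gsc] d dxz' by (simp add: comp_def)
  qed (use s in auto)
  ultimately show ?case by (meson converse_rtranclp_into_rtranclp)
qed

section \<open>Words in the wall reflections, and freeness of the action on alcoves\<close>

primrec word :: "('a \<Rightarrow> 'a) list \<Rightarrow> 'a \<Rightarrow> 'a" where
  "word [] = id"
| "word (s # ss) = s \<circ> word ss"

lemma word_append: "word (ss @ ts) = word ss \<circ> word ts"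
  by (induction ss) (auto simp: comp_assoc)

lemma word_in_RG: "set ss \<subseteq> walls c \<Longrightarrow> word ss \<in> RG"
  by (induction ss) (auto intro: RG_id RG_comp walls_in_RG)

lemma word_rev: "set ss \<subseteq> walls c \<Longrightarrow> word ss \<circ> word (rev ss) = id"
proof (induction ss)
  case (Cons s ss)
  have "word (s # ss) \<circ> word (rev (s # ss)) = s \<circ> (word ss \<circ> word (rev ss)) \<circ> s"
    by (simp add: word_append comp_assoc)
  then show ?case using Cons walls_self[of s c] by (simp only: set_simps insert_subset comp_id)
qed simp

lemma word_transitive:
  assumes "reg c" "reg y"
  obtains ss where "set ss \<subseteq> walls c" "eqv (word ss c) y"
proof -
  obtain g where g: "eqv (g c) y" "(gallery_step c (\<lambda>_. True))\<^sup>*\<^sup>* id g"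
    using gallery[of UNIV c y id c "\<lambda>_. True"] assms aut_id by auto
  from g(2) have "\<exists>ss. set ss \<subseteq> walls c \<and> g = word ss"
  proof induction
    case base
    then show ?case by (intro exI[of _ "[]"]) simp
  next
    case (step g g')
    from step.IH obtain ss where ss: "set ss \<subseteq> walls c" "g = word ss" by blast
    from step.hyps obtain s where s: "s \<in> walls c" "g' = g \<circ> s"
      unfolding gallery_step_def by blast
    have "g' = word (ss @ [s])" unfolding s(2) ss(2) by (simp add: word_append)
    then show ?case using ss(1) s(1) by (intro exI[of _ "ss @ [s]"]) auto
  qed
  then show thesis using that g(1) by blast
qed

lemma RG_transitive:
  assumes "reg c" "reg y"
  obtains z where "z \<in> RG" "eqv (z c) y"
  using word_transitive[OF assms] word_in_RG by metis

text \<open>A generic point of the hyperplane lies on a face of some alcove; a word carrying the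
  base alcove there conjugates a wall of the base alcove to the given hyperplane.\<close>
lemma affrefl_word:
  assumes "reg c" and b: "\<beta> \<in> \<Psi>"
  obtains ss where "set ss \<subseteq> walls c" "affrefl \<beta> l = word ss"
proof -
  have bnz: "\<beta> \<noteq> 0" using root_nonzero[OF b] .
  then have bb: "\<beta> \<bullet> \<beta> > 0" by simp
  \<comment> \<open>Orthogonal projection onto the hyperplane of (\<beta>, l).\<close>
  define pr where "pr = (\<lambda>x. x - ((\<beta> \<bullet> x - of_int l) / (\<beta> \<bullet> \<beta>)) *\<^sub>R \<beta>)"
  define I where "I = {(\<gamma>, j::int). \<gamma> \<in> \<Psi> \<and> \<gamma> \<noteq> \<beta> \<and> \<gamma> \<noteq> - \<beta>}"
  \<comment> \<open>\<open>n (\<gamma>, j) \<bullet> x = d (\<gamma>, j)\<close> means that the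
    projection of \<open>x\<close> lies on the hyperplane of (\<gamma>, j).\<close>
  define n where "n = (\<lambda>(\<gamma>, j::int). \<gamma> - ((\<gamma> \<bullet> \<beta>) / (\<beta> \<bullet> \<beta>)) *\<^sub>R \<beta>)"
  define d where "d = (\<lambda>(\<gamma>, j::int). of_int j - of_int l * (\<gamma> \<bullet> \<beta>) / (\<beta> \<bullet> \<beta>))"
  have "countable I"
    by (rule countable_subset[of _ "\<Psi> \<times> UNIV"]) (auto simp: I_def finite_roots countable_finite)
  have n: "n i \<noteq> 0" if "i \<in> I" for i
  proof
    assume "n i = 0"
    obtain \<gamma> j where i: "i = (\<gamma>, j)" by (metis surj_pair)
    have "\<gamma> = ((\<gamma> \<bullet> \<beta>) / (\<beta> \<bullet> \<beta>)) *\<^sub>R \<beta>" using \<open>n i = 0\<close> by (simp add: n_def i)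
    moreover from this have "(\<gamma> \<bullet> \<beta>) / (\<beta> \<bullet> \<beta>) = 1 \<or> (\<gamma> \<bullet> \<beta>) / (\<beta> \<bullet> \<beta>) = -1"
      using reduced[OF b, of "(\<gamma> \<bullet> \<beta>) / (\<beta> \<bullet> \<beta>)"] that unfolding i I_def by (metis (mono_tags, lifting) case_prodD mem_Collect_eq)
    ultimately have "\<gamma> = \<beta> \<or> \<gamma> = - \<beta>" by (metis scaleR_minus1_left scaleR_one)
    then show False using that unfolding i I_def by auto
  qed
  obtain x where x: "\<And>i. i \<in> I \<Longrightarrow> n i \<bullet> x \<noteq> d i"
    using generic_point[of I n UNIV d] \<open>countable I\<close> n by auto
  define p where "p = pr x"
  have bp: "\<beta> \<bullet> p = of_int l" using bb by (simp add: p_def pr_def inner_diff_right)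
  have other: "\<gamma> \<bullet> p \<noteq> of_int j" if "\<gamma> \<in> \<Psi>" "\<gamma> \<noteq> \<beta>" "\<gamma> \<noteq> - \<beta>" for \<gamma> j
  proof
    assume "\<gamma> \<bullet> p = of_int j"
    then have "n (\<gamma>, j) \<bullet> x = d (\<gamma>, j)"
      using bb by (simp add: p_def pr_def n_def d_def inner_diff_right inner_diff_left inner_commute field_simps)
    then show False using x[of "(\<gamma>, j)"] that by (auto simp: I_def)
  qed
  obtain e where e: "e > 0"
    "\<And>z \<beta> l. z \<in> ball p e \<Longrightarrow> \<beta> \<in> \<Psi> \<Longrightarrow> \<beta> \<bullet> p < of_int l \<Longrightarrow> \<beta> \<bullet> z < of_int l"
    "\<And>z \<beta> l. z \<in> ball p e \<Longrightarrow> \<beta> \<in> \<Psi> \<Longrightarrow> of_int l < \<beta> \<bullet> p \<Longrightarrow> of_int l < \<beta> \<bullet> z"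
    using locally_finite[of p] by blast
  define \<delta> where "\<delta> = e / (2 * norm \<beta>)"
  have \<delta>: "\<delta> > 0" "\<delta> * norm \<beta> < e" using e(1) bnz by (auto simp: \<delta>_def)
  define y where "y = p - \<delta> *\<^sub>R \<beta>"
  define y' where "y' = affrefl \<beta> l y"
  have yb: "y \<in> ball p e" using \<delta> by (simp add: y_def dist_norm)
  have y'b: "y' \<in> ball p e"
    using dist_affrefl[OF bnz, of l p y] affrefl_eq_self[OF bp] yb by (simp add: y'_def)
  have ylt: "\<beta> \<bullet> y < of_int l" using bp bb \<delta>(1) by (simp add: y_def inner_diff_right)
  have ygt: "\<beta> \<bullet> y' > of_int l" using ylt by (simp add: y'_def inner_affrefl[OF bnz])
  have nb: "\<gamma> \<bullet> y \<noteq> of_int j" if "\<gamma> \<in> \<Psi>" for \<gamma> j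
  proof (cases "\<gamma> \<bullet> p = of_int j")
    case False
    then show ?thesis using e(2,3)[OF yb that, of j] by linarith
  next
    case True
    then have "\<gamma> = \<beta> \<or> \<gamma> = - \<beta>" using other that by blast
    then show ?thesis using True bp ylt by auto
  qed
  then have "reg y" unfolding reg_def by (metis Ints_cases)
  have "sep y y' = {(\<beta>, l)}"
  proof (intro equalityI subsetI)
    fix h assume hh: "h \<in> sep y y'"
    obtain \<gamma> j where h: "h = (\<gamma>, j)" by (metis surj_pair)
    have c: "\<gamma> \<in> \<Psi>" "\<gamma> \<bullet> y < of_int j" "of_int j \<le> \<gamma> \<bullet> y'" using hh h by (auto simp: sep_def)
    have "\<gamma> \<bullet> p = of_int j"
      using e(2)[OF y'b c(1), of j] e(3)[OF yb c(1), of j] c by linarith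
    then have "\<gamma> = \<beta> \<or> \<gamma> = - \<beta>" using other c by blast
    then show "h \<in> {(\<beta>, l)}" using \<open>\<gamma> \<bullet> p = of_int j\<close> bp ylt c h by auto
  next
    fix h assume "h \<in> {(\<beta>, l)}"
    then show "h \<in> sep y y'" using b ylt ygt by (simp add: sep_def)
  qed
  then have sy: "sep y (affrefl \<beta> l y) = {(\<beta>, l)}" by (simp add: y'_def)
  obtain ss where ss: "set ss \<subseteq> walls c" "eqv (word ss c) y"
    using word_transitive[OF assms(1) \<open>reg y\<close>] .
  obtain s where s: "s \<in> walls c" "word ss \<circ> s = affrefl \<beta> l \<circ> word ss"
    using wall_conj[OF RG_aut[OF word_in_RG[OF ss(1)]] b ss(2) sy] .
  have "word (ss @ [s] @ rev ss) = affrefl \<beta> l \<circ> (word ss \<circ> word (rev ss))"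
    using s(2) by (simp add: word_append comp_assoc[symmetric])
  then show thesis using that[of "ss @ [s] @ rev ss"] word_rev[OF ss(1)] ss(1) s(1) by simp
qed

lemma RG_word:
  assumes "reg c" "g \<in> RG"
  shows "\<exists>ss. set ss \<subseteq> walls c \<and> g = word ss"
  using assms(2)
proof (induction g rule: RG.induct)
  case RG_id
  then show ?case by (intro exI[of _ "[]"]) simp
next
  case (RG_affrefl g \<alpha> k)
  then obtain ss where ss: "set ss \<subseteq> walls c" "g = word ss" by blast
  obtain ts where "set ts \<subseteq> walls c" "affrefl \<alpha> k = word ts"
    using affrefl_word[OF assms(1) RG_affrefl(2)] .
  then have "set (ts @ ss) \<subseteq> walls c" "affrefl \<alpha> k \<circ> g = word (ts @ ss)"
    unfolding word_append using ss by simp_all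
  then show ?case by blast
qed

text \<open>A word is a gallery starting at \<open>c\<close>, so a hyperplane separating its ends is
  crossed at some letter, and the reflection in it is that letter conjugated by the prefix before
  it. In the induction, the hyperplane is pulled back along the first letter.\<close>

lemma word_crossing:
  assumes c: "reg c" and "set ss \<subseteq> walls c" "\<beta> \<in> \<Psi>" "of_int l \<le> \<beta> \<bullet> c" "\<beta> \<bullet> word ss c < of_int l"
  shows "\<exists>us s vs. ss = us @ [s] @ vs \<and> word us \<circ> s = affrefl \<beta> l \<circ> word us"
  using assms(2-)
proof (induction ss arbitrary: \<beta> l)
  case Nil
  then show ?case by simp
next
  case (Cons s ss)
  obtain \<alpha> k where s: "s = affrefl \<alpha> k" "\<alpha> \<in> \<Psi>" "sep c (affrefl \<alpha> k c) = {(\<alpha>, k)}"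
    using Cons.prems(1) by (auto simp: walls_def)
  show ?case
  proof (cases "of_int l \<le> \<beta> \<bullet> s c")
    \<comment> \<open>The first letter already crosses the hyperplane, which must then be its own
      wall.\<close>
    case False
    then have "(- \<beta>, - l) \<in> sep c (s c)"
      using Cons.prems uminus_root reg_less_iff[OF c Cons.prems(2)] by (simp add: sep_def)
    then have "\<beta> = - \<alpha>" "l = - k" using s by auto
    then have "s = affrefl \<beta> l" unfolding s(1) by (metis affrefl_uminus)
    then show ?thesis by (intro exI[of _ "[]"] exI[of _ s] exI[of _ ss]) simp
  next
    case True
    obtain L m where L: "induces s L m" using aut_induces[OF aut_affrefl[OF s(2), of k, folded s(1)]] .
    obtain \<gamma> where \<gamma>: "\<gamma> \<in> \<Psi>" "\<beta> = L \<gamma>" using induces_rootE[OF L Cons.prems(2)] .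
    have ge: "of_int (l - m \<gamma>) \<le> \<gamma> \<bullet> c" using True induces_inner[OF L \<gamma>(1)] \<gamma>(2) by simp
    have lt: "\<gamma> \<bullet> word ss c < of_int (l - m \<gamma>)"
      using Cons.prems(4) induces_inner[OF L \<gamma>(1)] \<gamma>(2) by simp
    have "set ss \<subseteq> walls c" using Cons.prems(1) by simp
    from Cons.IH[OF this \<gamma>(1) ge lt] obtain us t vs where u: "ss = us @ [t] @ vs"
      "word us \<circ> t = affrefl \<gamma> (l - m \<gamma>) \<circ> word us"
      by blast
    have "word (s # us) \<circ> t = s \<circ> (word us \<circ> t)" by (simp add: comp_assoc)
    also have "\<dots> = (s \<circ> affrefl \<gamma> (l - m \<gamma>)) \<circ> word us" unfolding u(2) by (simp add: comp_assoc)
    also have "s \<circ> affrefl \<gamma> (l - m \<gamma>) = affrefl \<beta> l \<circ> s"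
      using induces_affrefl[OF L \<gamma>(1), of "l - m \<gamma>"] \<gamma>(2) by auto
    finally have "word (s # us) \<circ> t = affrefl \<beta> l \<circ> word (s # us)"
      by (simp add: fun_eq_iff)
    moreover have "s # ss = (s # us) @ [t] @ vs" using u(1) by simp
    ultimately show ?thesis by blast
  qed
qed

text \<open>The hyperplane crossed by the first letter has to be crossed back by a later one;
  both letters can then be deleted.\<close>
lemma word_free:
  assumes "reg c" "set ss \<subseteq> walls c" "eqv (word ss c) c"
  shows "word ss = id"
  using assms(2,3)
proof (induction "length ss" arbitrary: ss rule: less_induct)
  case less
  show ?case
  proof (cases ss)
    case Nil
    then show ?thesis by simp
  next
    case (Cons s ts)
    obtain \<alpha> k where s: "s = affrefl \<alpha> k" "\<alpha> \<in> \<Psi>" "sep c (affrefl \<alpha> k c) = {(\<alpha>, k)}"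
      using less.prems(1) Cons by (auto simp: walls_def)
    have anz: "\<alpha> \<noteq> 0" using root_nonzero s by blast
    have "(\<alpha>, k) \<in> sep c (affrefl \<alpha> k c)" using s by simp
    then have ac: "\<alpha> \<bullet> c < of_int k" by (simp add: sep_def)
    have "\<lfloor>\<alpha> \<bullet> word ss c\<rfloor> = \<lfloor>\<alpha> \<bullet> c\<rfloor>" using less.prems(2) s(2) by (simp add: eqv_def)
    then have "\<alpha> \<bullet> word ss c < of_int k" using ac by (metis floor_less_iff)
    \<comment> \<open>The whole word ends on the side of \<open>c\<close>, so without its first
      letter it ends on the far side.\<close>
    then have "(- \<alpha>) \<bullet> word ts c < of_int (- k)"
      using Cons inner_affrefl[OF anz, of k "word ts c"] s(1) by simp
    then obtain us t vs where u: "ts = us @ [t] @ vs" "word us \<circ> t = affrefl (- \<alpha>) (- k) \<circ> word us"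
      using word_crossing[OF assms(1), of ts "- \<alpha>" "- k"] less.prems(1) Cons uminus_root[OF s(2)] ac by auto
    have "s \<circ> (word us \<circ> t) = word us"
      unfolding u(2) affrefl_uminus s(1) using affrefl_comp_self[OF s(2)] by (simp flip: comp_assoc)
    then have eq: "word ss = word (us @ vs)"
      by (simp add: Cons u(1) word_append flip: comp_assoc)
    then show ?thesis
      using less.hyps[of "us @ vs"] less.prems Cons u(1) by simp
  qed
qed

lemma RG_free:
  assumes "reg c" "g \<in> RG" "eqv (g c) c"
  shows "g = id"
  using RG_word[OF assms(1,2)] word_free[OF assms(1)] assms(3) by auto

lemma RG_eq:
  assumes "reg c" "g \<in> RG" "h \<in> RG" "eqv (g c) (h c)"
  shows "g = h"
proof -
  have bij: "bij h" using assms(3) RG_aut aut_bij by blast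
  have "eqv ((inv h \<circ> g) c) c"
    using eqv_autI[OF aut_inv[OF RG_aut[OF assms(3)]] assms(4)] bij by (simp add: bij_is_inj)
  then have "inv h \<circ> g = id" using RG_free[OF assms(1)] RG_comp RG_inv assms(2,3) by blast
  then have "h \<circ> (inv h \<circ> g) = h" by simp
  then show ?thesis using bij by (metis bij_is_surj comp_assoc id_comp surj_iff)
qed

section \<open>Straight alcoves\<close>

definition straight_at :: "('a \<Rightarrow> 'a) \<Rightarrow> 'a \<Rightarrow> bool" where
  "straight_at w x \<longleftrightarrow> (\<forall>m. dst x ((w ^^ m) x) = m * dst x (w x))"

lemma aut_funpow: "aut w \<Longrightarrow> aut (w ^^ m)"
  by (induction m) (simp_all only: funpow.simps aut_id aut_comp)

lemma dst_funpow_le: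
  assumes "aut w"
  shows "dst y ((w ^^ m) y) \<le> m * dst y (w y)"
proof (induction m)
  case (Suc m)
  have "dst y ((w ^^ Suc m) y) \<le> dst y (w y) + dst (w y) (w ((w ^^ m) y))"
    using dst_triangle by simp
  then show ?case using Suc dst_aut[OF assms] by simp
qed simp

text \<open>A detour from \<open>x\<close> to \<open>y\<close> and back costs an amount independent
  of \<open>m\<close>, so the distances moved by the powers grow at the same rate
  everywhere.\<close>

lemma dst_funpow_compare:
  assumes "aut w"
  shows "dst x ((w ^^ m) x) \<le> dst x y + dst y x + dst y ((w ^^ m) y)"
proof -
  have "dst x ((w ^^ m) x) \<le> dst x y + (dst y ((w ^^ m) y) + dst ((w ^^ m) y) ((w ^^ m) x))"
    using dst_triangle[of x "(w ^^ m) x" y] dst_triangle[of y "(w ^^ m) x" "(w ^^ m) y"] by simp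
  then show ?thesis using dst_aut[OF aut_funpow[OF assms], of m y x] by simp
qed

lemma straight_at_minimal:
  assumes "aut w" "straight_at w x"
  shows "dst x (w x) \<le> dst y (w y)"
proof (rule ccontr)
  assume "\<not> ?thesis"
  then have lt: "dst y (w y) + 1 \<le> dst x (w x)" by simp
  \<comment> \<open>One more than the constant error, so that a gain of one per step can no longer
    be absorbed.\<close>
  define m where "m = dst x y + dst y x + 1"
  have "m * (dst y (w y) + 1) \<le> m * dst x (w x)" using lt by (rule mult_le_mono2)
  also have "\<dots> = dst x ((w ^^ m) x)" using assms(2) by (simp add: straight_at_def)
  also have "\<dots> \<le> dst x y + dst y x + dst y ((w ^^ m) y)" by (rule dst_funpow_compare[OF assms(1)])
  also have "\<dots> \<le> dst x y + dst y x + m * dst y (w y)" using dst_funpow_le[OF assms(1)] by simp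
  finally show False by (simp add: m_def)
qed

text \<open>A deficit of one at some power \<open>m\<close> recurs in every block of
  \<open>m\<close> steps; after \<open>K + 1\<close> blocks it exceeds the bounded error
  \<open>K\<close>.\<close>

lemma minimal_straight_at:
  assumes "aut w" "straight_at w x" "dst y (w y) \<le> dst x (w x)"
  shows "straight_at w y"
  unfolding straight_at_def
proof (rule allI, rule ccontr)
  fix m assume ne: "dst y ((w ^^ m) y) \<noteq> m * dst y (w y)"
  have eq: "dst y (w y) = dst x (w x)"
    using straight_at_minimal[OF assms(1,2), of y] assms(3) by simp
  define K where "K = dst x y + dst y x"
  have "dst y ((w ^^ m) y) + 1 \<le> m * dst x (w x)"
    using ne dst_funpow_le[OF assms(1), of y m] eq by simp
  then have b: "(K + 1) * (dst y ((w ^^ m) y) + 1) \<le> (K + 1) * (m * dst x (w x))"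
    by (rule mult_le_mono2)
  have "(K + 1) * (m * dst x (w x)) = dst x ((w ^^ (m * (K + 1))) x)"
    using assms(2) by (simp add: straight_at_def algebra_simps)
  also have "\<dots> \<le> K + dst y ((w ^^ (m * (K + 1))) y)"
    unfolding K_def by (rule dst_funpow_compare[OF assms(1)])
  also have "dst y ((w ^^ (m * (K + 1))) y) \<le> (K + 1) * dst y ((w ^^ m) y)"
    using dst_funpow_le[OF aut_funpow[OF assms(1)], of y "K + 1" m] by (simp only: funpow_mult)
  finally show False using b by simp
qed

text \<open>\<open>\<mu>/n\<close> is the Newton point of \<open>w\<close>, up to the directions orthogonal to all roots.\<close>
definition drift :: "('a \<Rightarrow> 'a) \<Rightarrow> nat \<Rightarrow> 'a \<Rightarrow> bool" where
  "drift w n \<mu> \<longleftrightarrow> n > 0 \<and> (\<forall>\<alpha>\<in>\<Psi>. \<forall>x. \<alpha> \<bullet> (w ^^ n) x = \<alpha> \<bullet> x + \<alpha> \<bullet> \<mu>)"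

text \<open>Some power of the linear part fixes every root; as seen by the roots, the same power of
  \<open>w\<close> is a translation.\<close>

lemma ex_drift:
  assumes "aut w"
  obtains n \<mu> where "drift w n \<mu>"
proof -
  obtain L p where w: "orthogonal_transformation L" "L ` \<Psi> = \<Psi>" "w = (\<lambda>x. p + L x)"
    using assms by (auto simp: aut_def)
  obtain n where n: "n > 0" "\<forall>\<alpha>\<in>\<Psi>. (L ^^ n) \<alpha> = \<alpha>"
    using finite_permutation_order[OF finite_roots w(2)] .
  have lin: "linear L" using w(1) by (simp add: orthogonal_transformation_def)
  have ex: "\<exists>q. \<forall>x. (w ^^ m) x = q + (L ^^ m) x" for m
  proof (induction m)
    case 0
    show ?case by (rule exI[of _ 0]) simp
  next
    case (Suc m)
    then obtain q where "\<forall>x. (w ^^ m) x = q + (L ^^ m) x" by blast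
    then show ?case by (intro exI[of _ "p + L q"]) (simp add: w(3) linear_add[OF lin])
  qed
  have inner: "(L ^^ m) x \<bullet> (L ^^ m) y = x \<bullet> y" for m x y
    using w(1) by (induction m) (auto simp: orthogonal_transformation_def)
  obtain q where q: "\<forall>x. (w ^^ n) x = q + (L ^^ n) x" using ex by blast
  have "\<alpha> \<bullet> (w ^^ n) x = \<alpha> \<bullet> x + \<alpha> \<bullet> q" if "\<alpha> \<in> \<Psi>" for \<alpha> x
    using inner[of n \<alpha> x] n(2) that q by (simp add: inner_add_right)
  then show thesis using that[of n q] n(1) by (simp add: drift_def)
qed

text \<open>\<open>w\<close> commutes with \<open>w ^^ n\<close>; evaluating both orders of
  composition at 0 compares the two drifts.\<close>

lemma drift_invariant:
  assumes "drift w n \<mu>" "\<alpha> \<in> \<Psi>" "\<beta> \<in> \<Psi>" "\<And>x. \<beta> \<bullet> w x = \<alpha> \<bullet> x + c"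
  shows "\<beta> \<bullet> \<mu> = \<alpha> \<bullet> \<mu>"
proof -
  have "\<beta> \<bullet> (w ^^ n) (w 0) = \<beta> \<bullet> w 0 + \<beta> \<bullet> \<mu>" "\<alpha> \<bullet> (w ^^ n) 0 = \<alpha> \<bullet> 0 + \<alpha> \<bullet> \<mu>"
    using assms(1-3) by (auto simp: drift_def)
  moreover have "(w ^^ n) (w 0) = w ((w ^^ n) 0)" by (simp add: funpow_swap1)
  ultimately show ?thesis using assms(4)[of 0] assms(4)[of "(w ^^ n) 0"] by simp
qed

text \<open>If \<alpha> \<bullet> \<mu> = 0, the condition applies to - \<alpha> as well; for an
  automorphism \<open>w\<close> and a regular point it then says that the floor of \<alpha> is
  preserved.\<close>

definition adm :: "('a \<Rightarrow> 'a) \<Rightarrow> 'a \<Rightarrow> 'a \<Rightarrow> bool" where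
  "adm w \<mu> x \<longleftrightarrow> (\<forall>\<alpha>\<in>\<Psi>. \<alpha> \<bullet> \<mu> \<le> 0 \<longrightarrow> \<lfloor>\<alpha> \<bullet> w x\<rfloor> \<le> \<lfloor>\<alpha> \<bullet> x\<rfloor>)"

text \<open>Straightness forces every half-space entered on the way from \<open>x\<close> to \<open>w x\<close> to contain all
  later iterates.\<close>
lemma straight_at_adm:
  assumes w: "aut w" and dr: "drift w n \<mu>" and st: "straight_at w x"
  shows "adm w \<mu> x"
  unfolding adm_def
proof (intro ballI impI)
  fix \<alpha> assume a: "\<alpha> \<in> \<Psi>" "\<alpha> \<bullet> \<mu> \<le> 0"
  obtain m where m: "n = Suc m" using dr by (auto simp: drift_def gr0_conv_Suc)
  \<comment> \<open>By straightness at \<open>m\<close> and \<open>n = Suc m\<close>, the sizes of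
    \<open>A\<close> and \<open>B\<close> add up to that of \<open>C\<close>, so the triangle
    inclusion is an equality.\<close>
  define A B C where "A = sep x (w x)" and "B = sep (w x) (w ((w ^^ m) x))" and "C = sep x ((w ^^ n) x)"
  have "C \<subseteq> A \<union> B" unfolding A_def B_def C_def m using sep_triangle by simp
  have "card B = m * card A"
    using dst_aut[OF w, of x "(w ^^ m) x"] st by (simp add: straight_at_def A_def B_def dst_def)
  moreover have "card C = n * card A" using st by (simp add: straight_at_def A_def C_def dst_def)
  ultimately have "card (A \<union> B) \<le> card C" using card_Un_le[of A B] by (simp add: m)
  then have "C = A \<union> B" using \<open>C \<subseteq> A \<union> B\<close> by (intro card_seteq) (auto simp: A_def B_def)
  show "\<lfloor>\<alpha> \<bullet> w x\<rfloor> \<le> \<lfloor>\<alpha> \<bullet> x\<rfloor>"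
  proof (rule ccontr)
    assume "\<not> ?thesis"
    then have "(\<alpha>, \<lfloor>\<alpha> \<bullet> w x\<rfloor>) \<in> A" using a by (simp add: A_def sep_eq_Sigma)
    then have "(\<alpha>, \<lfloor>\<alpha> \<bullet> w x\<rfloor>) \<in> C" using \<open>C = A \<union> B\<close> by simp
    then have "\<alpha> \<bullet> x < \<alpha> \<bullet> (w ^^ n) x" by (auto simp: C_def sep_def)
    then show False using dr a by (simp add: drift_def)
  qed
qed

lemma adm_step:
  assumes w: "aut w" and dr: "drift w n \<mu>" and "adm w \<mu> x"
  shows "adm w \<mu> (w x)"
  unfolding adm_def
proof (intro ballI impI)
  fix \<beta> assume b: "\<beta> \<in> \<Psi>" "\<beta> \<bullet> \<mu> \<le> 0"
  obtain L m where L: "induces w L m" using aut_induces[OF w] .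
  obtain \<alpha> where a: "\<alpha> \<in> \<Psi>" "\<beta> = L \<alpha>" using induces_rootE[OF L b(1)] .
  have inner: "\<beta> \<bullet> w y = \<alpha> \<bullet> y + of_int (m \<alpha>)" for y using induces_inner[OF L a(1)] a(2) by simp
  have "\<alpha> \<bullet> \<mu> \<le> 0" using drift_invariant[OF dr a(1) b(1) inner] b(2) by simp
  then have "\<lfloor>\<alpha> \<bullet> w x\<rfloor> \<le> \<lfloor>\<alpha> \<bullet> x\<rfloor>" using assms(3) a(1) by (simp add: adm_def)
  then show "\<lfloor>\<beta> \<bullet> w (w x)\<rfloor> \<le> \<lfloor>\<beta> \<bullet> w x\<rfloor>" using inner by simp
qed

lemma adm_funpow_floor:
  assumes w: "aut w" and dr: "drift w n \<mu>" and "adm w \<mu> x" "\<alpha> \<in> \<Psi>" "\<alpha> \<bullet> \<mu> \<le> 0"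
  shows "\<lfloor>\<alpha> \<bullet> (w ^^ m) x\<rfloor> \<le> \<lfloor>\<alpha> \<bullet> x\<rfloor>"
  using assms(3)
proof (induction m arbitrary: x)
  case (Suc m)
  have "\<lfloor>\<alpha> \<bullet> (w ^^ m) (w x)\<rfloor> \<le> \<lfloor>\<alpha> \<bullet> w x\<rfloor>" using Suc adm_step[OF w dr] by blast
  also have "\<dots> \<le> \<lfloor>\<alpha> \<bullet> x\<rfloor>" using Suc(2) assms(4,5) by (simp add: adm_def)
  finally show ?case by (simp add: funpow_swap1)
qed simp

lemma adm_funpow_floor':
  assumes w: "aut w" and dr: "drift w n \<mu>" and "adm w \<mu> x" "reg x" "\<alpha> \<in> \<Psi>" "0 \<le> \<alpha> \<bullet> \<mu>"
  shows "\<lfloor>\<alpha> \<bullet> x\<rfloor> \<le> \<lfloor>\<alpha> \<bullet> (w ^^ m) x\<rfloor>"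
proof -
  have "reg ((w ^^ m) x)" using reg_aut aut_funpow w assms(4) by blast
  then show ?thesis
    using adm_funpow_floor[OF w dr assms(3) uminus_root[OF assms(5)], of m] assms(4-6)
    by (simp add: reg_def floor_uminus)
qed

text \<open>Along the orbit the floor of each root is monotone, in the direction given by the sign
  of its drift. No crossing is ever undone, so the counts of successive steps add up.\<close>

lemma adm_straight_at:
  assumes w: "aut w" and dr: "drift w n \<mu>" and "adm w \<mu> x" "reg x"
  shows "straight_at w x"
  unfolding straight_at_def
proof
  fix m show "dst x ((w ^^ m) x) = m * dst x (w x)"
  proof (induction m)
    case (Suc m)
    define A B C where "A = sep x (w x)" and "B = sep (w x) (w ((w ^^ m) x))" and "C = sep x ((w ^^ Suc m) x)"
    have adm': "adm w \<mu> (w x)" and reg': "reg (w x)"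
      using adm_step[OF w dr assms(3)] reg_aut[OF w assms(4)] .
    have z: "w ((w ^^ m) x) = (w ^^ m) (w x)" by (simp add: funpow_swap1)
    have "A \<inter> B = {}" by (auto simp: A_def B_def sep_eq_Sigma)
    have "A \<union> B \<subseteq> C"
    proof
      fix h assume h: "h \<in> A \<union> B"
      obtain \<alpha> k where hk: "h = (\<alpha>, k)" by (metis surj_pair)
      have a: "\<alpha> \<in> \<Psi>" using h hk by (auto simp: A_def B_def sep_def)
      note down = adm_funpow_floor[OF w dr assms(3) a, of 1] adm_funpow_floor[OF w dr adm' a, of m]
      note up = adm_funpow_floor'[OF w dr assms(3,4) a, of 1] adm_funpow_floor'[OF w dr adm' reg' a, of m]
      show "h \<in> C"
      proof (cases "\<alpha> \<bullet> \<mu> \<le> 0")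
        \<comment> \<open>Such half-spaces are never entered, so neither \<open>A\<close> nor
          \<open>B\<close> contains one.\<close>
        case True
        then show ?thesis using h hk down by (auto simp: A_def B_def sep_eq_Sigma z)
      next
        case False
        then show ?thesis using h hk up by (auto simp: A_def B_def C_def sep_eq_Sigma z)
      qed
    qed
    moreover have "C \<subseteq> A \<union> B" unfolding A_def B_def C_def using sep_triangle by simp
    ultimately have "C = A \<union> B" by (rule equalityI[rotated])
    then have "card C = card A + card B"
      using card_Un_disjoint[OF _ _ \<open>A \<inter> B = {}\<close>] by (simp add: A_def B_def)
    then have "dst x ((w ^^ Suc m) x) = dst x (w x) + dst (w x) (w ((w ^^ m) x))"
      by (simp add: A_def B_def C_def dst_def)
    then show ?case using Suc dst_aut[OF w] by simp
  qed simp
qed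

section \<open>Walking from a point towards its image: segments, convergence, genericity\<close>

lemma dst_segment:
  assumes "0 \<le> t" "t \<le> 1" and z: "z = (1 - t) *\<^sub>R x + t *\<^sub>R y"
  shows "dst x z + dst z y = dst x y"
proof -
  have inner: "\<alpha> \<bullet> z = (1 - t) * (\<alpha> \<bullet> x) + t * (\<alpha> \<bullet> y)" for \<alpha> by (simp add: z inner_add_right)
  have "sep x z \<inter> sep z y = {}" by (auto simp: sep_def)
  moreover have "sep x y = sep x z \<union> sep z y"
  proof
    show "sep x z \<union> sep z y \<subseteq> sep x y"
    proof
      fix h assume h: "h \<in> sep x z \<union> sep z y"
      obtain \<alpha> k where hk: "h = (\<alpha>, k)" by (metis surj_pair)
      \<comment> \<open>Half-spaces and their complements are convex, so a segment crosses each
        hyperplane at most once.\<close>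
      have 1: "\<alpha> \<bullet> z < of_int k" if "\<alpha> \<bullet> x < of_int k" "\<alpha> \<bullet> y < of_int k"
        unfolding inner using convex_bound_lt[of "\<alpha> \<bullet> x" "of_int k" "\<alpha> \<bullet> y" "1 - t" t] that assms by simp
      have 2: "of_int k \<le> \<alpha> \<bullet> z" if "of_int k \<le> \<alpha> \<bullet> x" "of_int k \<le> \<alpha> \<bullet> y"
        unfolding inner using convex_bound_le[of "- (\<alpha> \<bullet> x)" "- of_int k" "- (\<alpha> \<bullet> y)" "1 - t" t] that assms by simp
      from h 1 2 show "h \<in> sep x y" unfolding hk sep_def by fastforce
    qed
  qed (rule sep_triangle)
  ultimately show ?thesis unfolding dst_def by (simp add: card_Un_disjoint)
qed

lemma aut_third_step:
  assumes "aut w"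
  shows "(w ^^ i) (third_step w x) = third_step w ((w ^^ i) x)"
proof (induction i)
  case (Suc i)
  obtain L p where w: "linear L" "w = (\<lambda>x. p + L x)"
    using assms by (auto simp: aut_def orthogonal_transformation_def)
  have "w (third_step w y) = third_step w (w y)" for y
  proof -
    have "w (third_step w y) = p + ((2/3) *\<^sub>R L y + (1/3) *\<^sub>R L (w y))"
      unfolding third_step_def w(2) by (simp only: linear_add[OF w(1)] linear_cmul[OF w(1)])
    also have "\<dots> = (2/3) *\<^sub>R (p + L y) + (1/3) *\<^sub>R (p + L (w y))"
      by (simp add: algebra_simps flip: scaleR_add_left)
    finally show ?thesis unfolding third_step_def w(2) .
  qed
  then show ?case using Suc by simp
qed simp

lemma third_step_tendsto:
  fixes x :: 'a
  assumes w: "aut w" and dr: "drift w n \<mu>" and a: "\<alpha> \<in> \<Psi>"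
  defines "y \<equiv> \<lambda>k. (third_step w ^^ k) x"
  shows "(\<lambda>k. \<alpha> \<bullet> w (y k) - \<alpha> \<bullet> y k) \<longlonglongrightarrow> (\<alpha> \<bullet> \<mu>) / n"
proof -
  \<comment> \<open>The deviation of the \<open>i\<close>-th increment along the orbit of
    \<open>y k\<close> from its mean. It is \<open>n\<close>-periodic with mean zero because
    \<open>n\<close> steps add \<alpha> \<bullet> \<mu>, and a third step averages consecutive
    increments.\<close>
  define F where "F k i = \<alpha> \<bullet> (w ^^ Suc i) (y k) - \<alpha> \<bullet> (w ^^ i) (y k) - (\<alpha> \<bullet> \<mu>) / n" for k i
  have n: "n > 0" using dr by (simp add: drift_def)
  have per: "\<alpha> \<bullet> (w ^^ (i + n)) z = \<alpha> \<bullet> (w ^^ i) z + \<alpha> \<bullet> \<mu>" for i z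
    using dr a by (simp add: drift_def add.commute[of i] funpow_add)
  have ys: "\<alpha> \<bullet> (w ^^ i) (y (Suc k)) = (2 * (\<alpha> \<bullet> (w ^^ i) (y k)) + \<alpha> \<bullet> (w ^^ Suc i) (y k)) / 3" for i k
    unfolding y_def by (simp add: aut_third_step[OF w]) (simp add: third_step_def inner_add_right)
  have "(\<lambda>k. F k 0) \<longlonglongrightarrow> 0"
  proof (rule averaging_tendsto_zero[OF n])
    show "F (Suc k) i = (2 * F k i + F k (Suc i)) / 3" for k i
      unfolding F_def ys by (simp add: field_simps)
    show "F k (i + n) = F k i" for k i
      using per[of i "y k"] per[of "Suc i" "y k"] by (simp add: F_def)
    show "(\<Sum>i<n. F k i) = 0" for k
    proof -
      have "(\<Sum>i<n. F k i) = (\<Sum>i<n. \<alpha> \<bullet> (w ^^ Suc i) (y k) - \<alpha> \<bullet> (w ^^ i) (y k)) - \<alpha> \<bullet> \<mu>"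
        using n by (simp add: F_def sum_subtractf)
      also have "\<dots> = 0" using per[of 0 "y k"] sum_lessThan_telescope[of "\<lambda>i. \<alpha> \<bullet> (w ^^ i) (y k)" n] by simp
      finally show ?thesis .
    qed
  qed
  then have "(\<lambda>k. F k 0 + (\<alpha> \<bullet> \<mu>) / n) \<longlonglongrightarrow> 0 + (\<alpha> \<bullet> \<mu>) / n" by (intro tendsto_add tendsto_const)
  then show ?thesis by (simp add: F_def)
qed

text \<open>Pulling a functional back along a third step yields 2/3 of it plus 1/3 of an isometric
  image of it; by comparison of norms these cannot cancel.\<close>

lemma third_step_affine:
  assumes "aut w" "\<beta> \<noteq> 0"
  shows "\<exists>\<gamma> c. \<gamma> \<noteq> 0 \<and> (\<forall>x. \<beta> \<bullet> (third_step w ^^ k) x = \<gamma> \<bullet> x + c)"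
  using assms(2)
proof (induction k arbitrary: \<beta>)
  case 0
  then show ?case by (intro exI[of _ \<beta>] exI[of _ 0]) simp
next
  case (Suc k)
  obtain L p where w: "orthogonal_transformation L" "w = (\<lambda>x. p + L x)"
    using assms(1) by (auto simp: aut_def)
  define M where "M = inv L"
  have LM: "L (M v) = v" for v
    using orthogonal_transformation_bij[OF w(1)] unfolding M_def by (simp add: bij_is_surj surj_f_inv_f)
  have nM: "norm (M v) = norm v" for v
    using orthogonal_transformation_norm[OF w(1), of "M v"] LM by simp
  have inner: "v \<bullet> L x = M v \<bullet> x" for v x
    using w(1) LM unfolding orthogonal_transformation_def by metis
  define \<beta>' where "\<beta>' = (2 / 3) *\<^sub>R \<beta> + (1 / 3) *\<^sub>R M \<beta>"
  have "\<beta>' \<noteq> 0"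
  proof
    assume "\<beta>' = 0"
    then have "(2 / 3) *\<^sub>R \<beta> = - ((1 / 3) *\<^sub>R M \<beta>)" unfolding \<beta>'_def by (rule eq_neg_iff_add_eq_0[THEN iffD2])
    then have "norm ((2 / 3) *\<^sub>R \<beta>) = norm ((1 / 3) *\<^sub>R M \<beta>)" by simp
    then show False using Suc(2) nM by simp
  qed
  from Suc(1)[OF this] obtain \<gamma> c where g: "\<gamma> \<noteq> 0" "\<forall>x. \<beta>' \<bullet> (third_step w ^^ k) x = \<gamma> \<bullet> x + c" by blast
  have "\<beta> \<bullet> (third_step w ^^ Suc k) x = \<gamma> \<bullet> x + (c + (\<beta> \<bullet> p) / 3)" for x
  proof -
    let ?z = "(third_step w ^^ k) x"
    have "\<beta> \<bullet> (third_step w ^^ Suc k) x = \<beta>' \<bullet> ?z + (\<beta> \<bullet> p) / 3"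
      by (simp add: third_step_def w(2) \<beta>'_def inner_add_right inner_add_left inner field_simps)
    then show ?thesis using g(2) by simp
  qed
  then show ?case using g(1) by blast
qed

text \<open>The hyperplanes to avoid are pull-backs along the iterates: one for each root, iterate
  and level, hence countably many.\<close>

lemma generic_third_steps:
  assumes "aut w" "reg x"
  obtains a where "a \<in> cell x" "\<And>k. reg ((third_step w ^^ k) a)"
proof -
  define I where "I = \<Psi> \<times> (UNIV :: nat set) \<times> (UNIV :: int set)"
  have "\<exists>\<gamma> c. \<forall>\<beta>\<in>\<Psi>. \<forall>k. \<gamma> \<beta> k \<noteq> 0 \<and> (\<forall>x. \<beta> \<bullet> (third_step w ^^ k) x = \<gamma> \<beta> k \<bullet> x + c \<beta> k)"
    using third_step_affine[OF assms(1)] root_nonzero by metis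
  then obtain \<gamma> c where g: "\<And>\<beta> k. \<beta> \<in> \<Psi> \<Longrightarrow> \<gamma> \<beta> k \<noteq> 0"
    "\<And>\<beta> k x. \<beta> \<in> \<Psi> \<Longrightarrow> \<beta> \<bullet> (third_step w ^^ k) x = \<gamma> \<beta> k \<bullet> x + c \<beta> k" by blast
  have "countable I" unfolding I_def using finite_roots countable_finite by blast
  moreover have "cell x \<noteq> {}" using cell_iff[of x x] assms(2) by auto
  moreover define \<gamma>' where "\<gamma>' = (\<lambda>(\<beta>, k, l :: int). \<gamma> \<beta> k)"
  moreover have "\<gamma>' i \<noteq> 0" if "i \<in> I" for i using that g(1) by (auto simp: \<gamma>'_def I_def)
  moreover define c' :: "'a \<times> nat \<times> int \<Rightarrow> real" where "c' = (\<lambda>(\<beta>, k, l). of_int l - c \<beta> k)"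
  ultimately obtain a where a: "a \<in> cell x" "\<And>i. i \<in> I \<Longrightarrow> \<gamma>' i \<bullet> a \<noteq> c' i"
    using generic_point[of I \<gamma>' "cell x" c'] open_cell by blast
  have "reg ((third_step w ^^ k) a)" for k
    unfolding reg_def
  proof (intro ballI notI)
    fix \<beta> assume b: "\<beta> \<in> \<Psi>" "\<beta> \<bullet> (third_step w ^^ k) a \<in> \<int>"
    then obtain l where "\<beta> \<bullet> (third_step w ^^ k) a = of_int l" by (auto elim: Ints_cases)
    then show False using a(2)[of "(\<beta>, k, l)"] b(1) g(2)[OF b(1)] by (simp add: I_def \<gamma>'_def c'_def)
  qed
  then show thesis using that a(1) by blast
qed

text \<open>For \<open>g\<close> in the reflection group, the distance is the length of the
  conjugate \<open>inv g \<circ> w \<circ> g\<close>; \<open>N\<close> will be the minimal length in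
  the class.\<close>

definition short :: "('a \<Rightarrow> 'a) \<Rightarrow> 'a \<Rightarrow> nat \<Rightarrow> ('a \<Rightarrow> 'a) \<Rightarrow> bool" where
  "short w c N g \<longleftrightarrow> dst (g c) (w (g c)) \<le> N"

lemma short_eqv:
  assumes "aut w" "eqv (g c) z"
  shows "short w c N g \<longleftrightarrow> dst z (w z) \<le> N"
  unfolding short_def using dst_cong[OF assms(2) eqv_autI[OF assms]] by simp

text \<open>Moving from \<open>x\<close> towards \<open>w x\<close> is a cyclic shift, so the length does not grow.\<close>
lemma gallery_third_step:
  assumes w: "aut w" and g: "aut g" "eqv (g c) x" "short w c N g" and reg: "reg x" "reg (third_step w x)"
  shows "\<exists>g'. aut g' \<and> eqv (g' c) (third_step w x) \<and> short w c N g' \<and> (gallery_step c (short w c N))\<^sup>*\<^sup>* g g'"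
proof -
  let ?y = "third_step w x"
  have seg: "dst x ?y + dst ?y (w x) = dst x (w x)"
    by (rule dst_segment[of "1/3"]) (simp_all add: third_step_def)
  have N: "dst x (w x) \<le> N" using short_eqv[OF w, of g c x N] g by simp
  have short: "short w c N g'" if "eqv (g' c) z" "dst x z + dst z ?y \<le> dst x ?y" for g' z
  proof -
    \<comment> \<open>From \<open>z\<close> one goes on through \<open>?y\<close> to
      \<open>w x\<close>; the last leg from \<open>w x\<close> to \<open>w z\<close> costs the same
      as the stretch from \<open>x\<close> to \<open>z\<close> that was skipped.\<close>
    have "dst z (w z) \<le> dst z (w x) + dst (w x) (w z)" by (rule dst_triangle)
    also have "\<dots> \<le> dst z ?y + dst ?y (w x) + dst x z" using dst_triangle dst_aut[OF w] by simp
    also have "\<dots> \<le> N" using that(2) seg N by simp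
    finally show ?thesis using short_eqv[OF w, of g' c z N] that(1) by simp
  qed
  have "\<exists>g'. aut g' \<and> eqv (g' c) ?y \<and> (gallery_step c (short w c N))\<^sup>*\<^sup>* g g'"
    by (rule gallery[of UNIV x ?y g c]) (use reg g short in auto)
  then show ?thesis using short[of _ ?y] by auto
qed

lemma gallery_third_steps:
  assumes w: "aut w" and g: "aut g" "eqv (g c) a" "short w c N g" and reg: "\<And>k. reg ((third_step w ^^ k) a)"
  shows "\<exists>g'. aut g' \<and> eqv (g' c) ((third_step w ^^ k) a) \<and> short w c N g' \<and> (gallery_step c (short w c N))\<^sup>*\<^sup>* g g'"
proof (induction k)
  case 0
  then show ?case using g by auto
next
  case (Suc k)
  then obtain g' where g': "aut g'" "eqv (g' c) ((third_step w ^^ k) a)" "short w c N g'"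
    "(gallery_step c (short w c N))\<^sup>*\<^sup>* g g'" by blast
  obtain g'' where "aut g''" "eqv (g'' c) ((third_step w ^^ Suc k) a)" "short w c N g''"
    "(gallery_step c (short w c N))\<^sup>*\<^sup>* g' g''"
    using gallery_third_step[OF w g'(1-3) reg] reg[of "Suc k"] by auto
  then show ?case using g'(4) rtranclp_trans by metis
qed

lemma gallery_RG:
  assumes "(gallery_step c G)\<^sup>*\<^sup>* g g'" "g \<in> RG"
  shows "g' \<in> RG"
  using assms
proof (induction rule: rtranclp_induct)
  case (step h h')
  then obtain s where "s \<in> walls c" "h' = h \<circ> s" unfolding gallery_step_def by blast
  then show ?case using RG_comp[OF step.IH[OF step.prems] walls_in_RG, of s c] by (simp only:)
qed

text \<open>The point is the midpoint of \<open>c\<close> and its mirror image. A half-space that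
  contains the midpoint but not \<open>c\<close> contains the mirror image too, so it is (\<alpha>,
  k).\<close>

lemma half_ball_in_cell:
  assumes c: "reg c" and a: "\<alpha> \<in> \<Psi>" and s: "sep c (affrefl \<alpha> k c) = {(\<alpha>, k)}"
  shows "\<exists>x. \<alpha> \<bullet> x = of_int k \<and> (\<exists>e>0. \<forall>y\<in>ball x e. \<alpha> \<bullet> y < of_int k \<longrightarrow> y \<in> cell c)"
proof -
  define c' where "c' = affrefl \<alpha> k c"
  define p where "p = (1 / 2) *\<^sub>R (c + c')"
  have p: "\<beta> \<bullet> p = (\<beta> \<bullet> c + \<beta> \<bullet> c') / 2" for \<beta> by (simp add: p_def inner_add_right)
  have ap: "\<alpha> \<bullet> p = of_int k"
    using inner_affrefl[OF root_nonzero[OF a], of k c] by (simp add: p c'_def)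
  obtain e where e: "e > 0"
    "\<And>z \<beta> l. z \<in> ball p e \<Longrightarrow> \<beta> \<in> \<Psi> \<Longrightarrow> \<beta> \<bullet> p < of_int l \<Longrightarrow> \<beta> \<bullet> z < of_int l"
    "\<And>z \<beta> l. z \<in> ball p e \<Longrightarrow> \<beta> \<in> \<Psi> \<Longrightarrow> of_int l < \<beta> \<bullet> p \<Longrightarrow> of_int l < \<beta> \<bullet> z"
    using locally_finite[of p] by blast
  have "y \<in> cell c" if y: "y \<in> ball p e" "\<alpha> \<bullet> y < of_int k" for y
  proof -
    have lt: "\<beta> \<bullet> y < of_int l" if b: "\<beta> \<in> \<Psi>" "\<beta> \<bullet> c < of_int l" for \<beta> l
    proof (cases "\<beta> \<bullet> p < of_int l")
      case True
      then show ?thesis using e(2) y b by blast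
    next
      case False
      then have "(\<beta>, l) \<in> sep c c'" using b p[of \<beta>] by (simp add: sep_def)
      then show ?thesis using s y(2) by (simp add: c'_def)
    qed
    have gt: "of_int l < \<beta> \<bullet> y" if "\<beta> \<in> \<Psi>" "of_int l < \<beta> \<bullet> c" for \<beta> l
      using lt[OF uminus_root[OF that(1)], of "- l"] that(2) by simp
    show ?thesis
      unfolding cell_def
    proof (intro CollectI ballI conjI)
      fix \<beta> assume b: "\<beta> \<in> \<Psi>"
      show "of_int \<lfloor>\<beta> \<bullet> c\<rfloor> < \<beta> \<bullet> y"
        using gt[OF b, of "\<lfloor>\<beta> \<bullet> c\<rfloor>"] reg_less_iff[OF c b, of "\<lfloor>\<beta> \<bullet> c\<rfloor>"] by linarith
      show "\<beta> \<bullet> y < of_int \<lfloor>\<beta> \<bullet> c\<rfloor> + 1"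
        using lt[OF b, of "\<lfloor>\<beta> \<bullet> c\<rfloor> + 1"] by simp
    qed
  qed
  then show ?thesis using ap e(1) by blast
qed

section \<open>The arrangement parallel to the drift, and the connection of straight alcoves\<close>

lemma gallery_sym:
  assumes "(gallery_step c G)\<^sup>*\<^sup>* g g'"
  shows "(gallery_step c G)\<^sup>*\<^sup>* g' g"
  using assms
  by (induction rule: rtranclp_induct) (auto intro: converse_rtranclp_into_rtranclp gallery_step_sym)

text \<open>The cells of this arrangement are the chambers cut out by the hyperplanes parallel to
  the drift, and simple transitivity becomes available for them.\<close>

lemma orthogonal_to_vector:
  fixes \<mu> :: 'a
  defines "\<Psi>' \<equiv> {\<alpha> \<in> \<Psi>. \<alpha> \<bullet> \<mu> = 0}"
  shows "affine_arrangement \<Psi>'"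
proof
  show "finite \<Psi>'" "0 \<notin> \<Psi>'" using finite_roots zero_not_root by (auto simp: \<Psi>'_def)
  show "refl \<alpha> \<beta> \<in> \<Psi>'" if "\<alpha> \<in> \<Psi>'" "\<beta> \<in> \<Psi>'" for \<alpha> \<beta>
    using that refl_closed by (simp add: \<Psi>'_def refl_def coroot_def inner_diff_left)
  show "\<beta> \<bullet> coroot \<alpha> \<in> \<int>" if "\<alpha> \<in> \<Psi>'" "\<beta> \<in> \<Psi>'" for \<alpha> \<beta>
    using that integral by (simp add: \<Psi>'_def)
  show "r = 1 \<or> r = -1" if "\<alpha> \<in> \<Psi>'" "r *\<^sub>R \<alpha> \<in> \<Psi>'" for \<alpha> r
    using that reduced[of \<alpha> r] by (simp add: \<Psi>'_def)
qed

text \<open>As \<open>w\<close> is affine, each condition describes an open half-space. Increments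
  that converge to negative limits for finitely many roots eventually satisfy all conditions at
  once.\<close>

lemma near_drift:
  assumes "aut w" and n: "n > 0"
  obtains U where "open U" "convex U"
    "\<And>x. x \<in> U \<Longrightarrow> \<forall>\<alpha>\<in>\<Psi>. \<alpha> \<bullet> \<mu> < 0 \<longrightarrow> \<alpha> \<bullet> w x < \<alpha> \<bullet> x"
    "\<And>y. (\<And>\<alpha>. \<alpha> \<in> \<Psi> \<Longrightarrow> (\<lambda>k. \<alpha> \<bullet> w (y k) - \<alpha> \<bullet> y k) \<longlonglongrightarrow> (\<alpha> \<bullet> \<mu>) / real n) \<Longrightarrow> \<exists>k::nat. y k \<in> U"
proof -
  obtain L p where w: "linear L" "w = (\<lambda>x. p + L x)"
    using assms by (auto simp: aut_def orthogonal_transformation_def)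
  define U where "U = (\<Inter>\<alpha>\<in>{\<alpha> \<in> \<Psi>. \<alpha> \<bullet> \<mu> < 0}. {x. \<alpha> \<bullet> w x < \<alpha> \<bullet> x})"
  have half: "{x. \<alpha> \<bullet> w x < \<alpha> \<bullet> x} = {x. (adjoint L \<alpha> - \<alpha>) \<bullet> x < - (\<alpha> \<bullet> p)}" for \<alpha>
  proof -
    have "\<alpha> \<bullet> L x = adjoint L \<alpha> \<bullet> x" for x
      using adjoint_works[OF w(1), of x \<alpha>] by (simp add: inner_commute)
    then show ?thesis by (auto simp: w(2) inner_add_right inner_diff_left)
  qed
  show thesis
  proof (rule that[of U])
    show "open U" unfolding U_def half using finite_roots by (intro open_INT ballI open_halfspace_lt) auto
    show "convex U" unfolding U_def half by (intro convex_INT convex_halfspace_lt)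
    show "\<forall>\<alpha>\<in>\<Psi>. \<alpha> \<bullet> \<mu> < 0 \<longrightarrow> \<alpha> \<bullet> w x < \<alpha> \<bullet> x" if "x \<in> U" for x using that by (auto simp: U_def)
    fix y assume lim: "\<And>\<alpha>. \<alpha> \<in> \<Psi> \<Longrightarrow> (\<lambda>k. \<alpha> \<bullet> w (y k) - \<alpha> \<bullet> y k) \<longlonglongrightarrow> (\<alpha> \<bullet> \<mu>) / real n"
    have "\<forall>\<^sub>F k in sequentially. \<forall>\<alpha>\<in>{\<alpha> \<in> \<Psi>. \<alpha> \<bullet> \<mu> < 0}. \<alpha> \<bullet> w (y k) - \<alpha> \<bullet> y k < 0"
    proof (rule eventually_ball_finite)
      show "\<forall>\<alpha>\<in>{\<alpha> \<in> \<Psi>. \<alpha> \<bullet> \<mu> < 0}. \<forall>\<^sub>F k in sequentially. \<alpha> \<bullet> w (y k) - \<alpha> \<bullet> y k < 0"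
        using n by (intro ballI order_tendstoD(2)[OF lim]) (auto simp: divide_neg_pos)
    qed (use finite_roots in simp)
    then obtain k where "\<forall>\<alpha>\<in>{\<alpha> \<in> \<Psi>. \<alpha> \<bullet> \<mu> < 0}. \<alpha> \<bullet> w (y k) - \<alpha> \<bullet> y k < 0"
      using eventually_happens' sequentially_bot by blast
    then show "\<exists>k. y k \<in> U" by (auto simp: U_def)
  qed
qed

text \<open>The factor \<open>z\<close> brings the second alcove into the chamber of the first.
  Since it commutes with \<open>w\<close>, conjugating \<open>w\<close> by
  \<open>z \<circ> g2\<close> or by \<open>g2\<close> gives the same element.\<close>

theorem straight_gallery:
  assumes w: "aut w" and c: "reg c" and xs: "straight_at w xs"
    and N: "N = dst xs (w xs)"
    and g1: "g1 \<in> RG" "short w c N g1" and g2: "g2 \<in> RG" "short w c N g2"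
  shows "\<exists>z\<in>RG. z \<circ> w = w \<circ> z \<and> (gallery_step c (short w c N))\<^sup>*\<^sup>* g1 (z \<circ> g2)"
proof -
  obtain n \<mu> where dr: "drift w n \<mu>" using ex_drift[OF w] .
  then have n: "n > 0" by (simp add: drift_def)
  define \<Psi>' where "\<Psi>' = {\<alpha> \<in> \<Psi>. \<alpha> \<bullet> \<mu> = 0}"
  \<comment> \<open>The prefix \<open>N.\<close> refers to the hyperplanes parallel to the drift and
    is unrelated to the number \<open>N\<close>.\<close>
  interpret N: affine_arrangement \<Psi>' unfolding \<Psi>'_def by (rule orthogonal_to_vector)
  have sub: "\<Psi>' \<subseteq> \<Psi>" by (auto simp: \<Psi>'_def)
  have Nreg: "N.reg x" if "reg x" for x using that sub by (auto simp: reg_def N.reg_def)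
  have Neqv: "N.eqv x y" if "eqv x y" for x y using that sub by (auto simp: eqv_def N.eqv_def)
  have NRG: "z \<in> RG" if "z \<in> N.RG" for z
    using that
  proof (induction z rule: N.RG.induct)
    case RG_id
    show ?case by (rule RG_id)
  next
    case (RG_affrefl g \<alpha> k)
    then show ?case using sub by (intro RG.RG_affrefl) auto
  qed
  have Nw: "N.aut w"
  proof -
    obtain L p where L: "orthogonal_transformation L" "L ` \<Psi> = \<Psi>" "\<forall>\<alpha>\<in>\<Psi>. \<alpha> \<bullet> p \<in> \<int>" "w = (\<lambda>x. p + L x)"
      using w by (auto simp: aut_def)
    have inv: "L \<alpha> \<bullet> \<mu> = \<alpha> \<bullet> \<mu>" if "\<alpha> \<in> \<Psi>" for \<alpha>
    proof (rule drift_invariant[OF dr that])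
      show "L \<alpha> \<in> \<Psi>" using L(2) that by blast
      show "L \<alpha> \<bullet> w x = \<alpha> \<bullet> x + L \<alpha> \<bullet> p" for x
        using L(1,4) by (simp add: inner_add_right orthogonal_transformation_def)
    qed
    have "L ` \<Psi>' = \<Psi>'"
    proof
      show "L ` \<Psi>' \<subseteq> \<Psi>'" using inv L(2) by (auto simp: \<Psi>'_def)
      show "\<Psi>' \<subseteq> L ` \<Psi>'"
      proof
        fix \<beta> assume b: "\<beta> \<in> \<Psi>'"
        then have "\<beta> \<in> L ` \<Psi>" using L(2) by (simp add: \<Psi>'_def)
        then obtain \<alpha> where "\<alpha> \<in> \<Psi>" "\<beta> = L \<alpha>" by blast
        then show "\<beta> \<in> L ` \<Psi>'" using inv b by (auto simp: \<Psi>'_def)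
      qed
    qed
    then show ?thesis unfolding N.aut_def using L sub by (intro exI[of _ L] exI[of _ p]) auto
  qed
  \<comment> \<open>Short alcoves have minimal length, so they are straight and therefore
    admissible.\<close>
  have adm: "adm w \<mu> (g c)" "reg (g c)" if "g \<in> RG" "short w c N g" for g
    using straight_at_adm[OF w dr minimal_straight_at[OF w xs]] that reg_aut[OF RG_aut c]
    by (auto simp: short_def N)
  have Nfix: "N.eqv (w x) x" if "adm w \<mu> x" "reg x" for x
    unfolding N.eqv_def
  proof
    fix \<alpha> assume "\<alpha> \<in> \<Psi>'"
    then have a: "\<alpha> \<in> \<Psi>" "\<alpha> \<bullet> \<mu> = 0" by (auto simp: \<Psi>'_def)
    show "\<lfloor>\<alpha> \<bullet> w x\<rfloor> = \<lfloor>\<alpha> \<bullet> x\<rfloor>"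
      using adm_funpow_floor[OF w dr that(1) a(1), of 1] adm_funpow_floor'[OF w dr that a(1), of 1] a(2)
      by simp
  qed
  define x1 x2 where "x1 = g1 c" and "x2 = g2 c"
  have x1: "adm w \<mu> x1" "reg x1" and x2: "adm w \<mu> x2" "reg x2"
    unfolding x1_def x2_def using adm g1 g2 by auto
  obtain v where v: "v \<in> N.RG" "N.eqv (v x1) x2"
    using N.RG_transitive[OF Nreg[OF x1(2)] Nreg[OF x2(2)]] .
  have Nv: "N.aut v" using N.RG_aut v(1) by blast
  \<comment> \<open>Both sides carry the chamber of \<open>w x1\<close>, which is that of
    \<open>x1\<close>, to the chamber of \<open>x2\<close>; freeness of the smaller reflection group
    identifies them.\<close>
  have "w \<circ> v \<circ> inv w = v"
  proof (rule N.RG_eq)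
    show "N.reg (w x1)" using Nreg[OF reg_aut[OF w x1(2)]] .
    show "w \<circ> v \<circ> inv w \<in> N.RG" "v \<in> N.RG" using N.RG_conj[OF Nw v(1)] v(1) .
    have "N.eqv (w (v x1)) (w x2)" using N.eqv_autI[OF Nw v(2)] .
    also have "N.eqv \<dots> x2" using Nfix x2 by blast
    also have "N.eqv \<dots> (v x1)" using N.eqv_sym[OF v(2)] .
    also have "N.eqv \<dots> (v (w x1))" using N.eqv_autI[OF Nv N.eqv_sym[OF Nfix[OF x1]]] .
    finally show "N.eqv ((w \<circ> v \<circ> inv w) (w x1)) (v (w x1))"
      using aut_bij[OF w] by (simp add: bij_is_inj)
  qed
  then have "w \<circ> v \<circ> (inv w \<circ> w) = v \<circ> w" by (simp only: comp_assoc[symmetric])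
  then have vw: "w \<circ> v = v \<circ> w" using aut_bij[OF w] by (simp add: bij_is_inj)
  define z where "z = inv v"
  have bv: "bij v" using N.aut_bij[OF Nv] .
  have vz: "v (z y) = y" "z (v y) = y" for y
    using bv by (auto simp: z_def bij_is_inj bij_is_surj surj_f_inv_f)
  have zw: "z (w y) = w (z y)" for y
  proof -
    have "v (w (z y)) = w y" using fun_cong[OF vw, of "z y"] vz by simp
    then have "z (v (w (z y))) = z (w y)" by simp
    then show ?thesis by (simp add: vz)
  qed
  have zN: "z \<in> N.RG" unfolding z_def using N.RG_inv v(1) by blast
  then have zR: "z \<in> RG" using NRG by blast
  define h2 where "h2 = z \<circ> g2"
  have h2: "h2 \<in> RG" unfolding h2_def using RG_comp zR g2(1) by blast
  have h2s: "short w c N h2"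
    using g2(2) dst_aut[OF RG_aut[OF zR], of x2 "w x2"] by (simp add: short_def h2_def x2_def zw)
  define C where "C = N.cell x1"
  have "N.eqv (z (v x1)) (z x2)" using N.eqv_autI[OF N.RG_aut[OF zN] v(2)] .
  then have "N.eqv x1 (h2 c)" by (simp add: vz h2_def x2_def)
  moreover have "reg (h2 c)" using reg_aut[OF RG_aut[OF h2] c] .
  ultimately have h2C: "h2 c \<in> C" unfolding C_def using N.cell_iff Nreg by blast
  have g1C: "g1 c \<in> C" unfolding C_def using N.cell_iff Nreg x1(2) by (simp add: x1_def)
  have C: "open C" "convex C" unfolding C_def by (rule N.open_cell, rule N.convex_cell)
  have wC: "w y \<in> C" if "y \<in> C" for y
  proof -
    have y: "N.reg y" "N.eqv x1 y" using that N.cell_iff unfolding C_def by auto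
    have "N.eqv x1 (w x1)" using N.eqv_sym[OF Nfix[OF x1]] .
    also have "N.eqv \<dots> (w y)" using N.eqv_autI[OF Nw y(2)] .
    finally show ?thesis unfolding C_def using N.cell_iff N.reg_aut[OF Nw y(1)] by blast
  qed
  \<comment> \<open>\<open>C\<close> is convex and \<open>w\<close>-stable, so the averaging walk
    does not leave it.\<close>
  have TC: "(third_step w ^^ k) y \<in> C" if "y \<in> C" for y k
  proof (induction k)
    case (Suc k)
    then show ?case
      using convexD[OF C(2) Suc wC[OF Suc], of "2/3" "1/3"] by (simp add: third_step_def)
  qed (use that in simp)
  obtain U where U: "open U" "convex U"
    "\<And>x. x \<in> U \<Longrightarrow> \<forall>\<alpha>\<in>\<Psi>. \<alpha> \<bullet> \<mu> < 0 \<longrightarrow> \<alpha> \<bullet> w x < \<alpha> \<bullet> x"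
    "\<And>y. (\<And>\<alpha>. \<alpha> \<in> \<Psi> \<Longrightarrow> (\<lambda>k. \<alpha> \<bullet> w (y k) - \<alpha> \<bullet> y k) \<longlonglongrightarrow> (\<alpha> \<bullet> \<mu>) / real n) \<Longrightarrow> \<exists>k::nat. y k \<in> U"
    using near_drift[OF w n, of \<mu>] by metis
  let ?S = "gallery_step c (short w c N)"
  \<comment> \<open>A generic representative of the alcove keeps all iterates regular, and the walk
    from it reaches \<open>U\<close> after finitely many short gallery pieces.\<close>
  have enter: "\<exists>h' y. h' \<in> RG \<and> y \<in> U \<inter> C \<and> reg y \<and> eqv (h' c) y \<and> ?S\<^sup>*\<^sup>* h h'"
    if h: "h \<in> RG" "short w c N h" "h c \<in> C" for h
  proof -
    have rh: "reg (h c)" using reg_aut[OF RG_aut[OF h(1)] c] .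
    obtain a where a: "a \<in> cell (h c)" "\<And>k. reg ((third_step w ^^ k) a)"
      using generic_third_steps[OF w rh] by blast
    have ea: "eqv (h c) a" "reg a" using a(1) cell_iff by auto
    have "N.eqv x1 a" using N.eqv_trans[OF _ Neqv[OF ea(1)]] h(3) N.cell_iff unfolding C_def by blast
    then have aC: "a \<in> C" using N.cell_iff Nreg[OF ea(2)] unfolding C_def by blast
    obtain k where k: "(third_step w ^^ k) a \<in> U"
      using U(4)[of "\<lambda>k. (third_step w ^^ k) a"] third_step_tendsto[OF w dr] by blast
    obtain h' where "eqv (h' c) ((third_step w ^^ k) a)" "?S\<^sup>*\<^sup>* h h'"
      using gallery_third_steps[OF w RG_aut[OF h(1)] ea(1) h(2) a(2), of k] by blast
    then show ?thesis using gallery_RG[of c _ h h'] h(1) k TC[OF aC, of k] a(2)[of k] by blast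
  qed
  \<comment> \<open>\<open>C\<close> controls the floors of the roots without drift,
    \<open>U\<close> those of the roots with negative drift; together they give admissibility and
    hence minimal length.\<close>
  have inside: "short w c N g'" if "y \<in> U \<inter> C" "reg y" "eqv (g' c) y" for g' y
  proof -
    have "adm w \<mu> y"
      unfolding adm_def
    proof (intro ballI impI)
      fix \<alpha> assume a: "\<alpha> \<in> \<Psi>" "\<alpha> \<bullet> \<mu> \<le> 0"
      show "\<lfloor>\<alpha> \<bullet> w y\<rfloor> \<le> \<lfloor>\<alpha> \<bullet> y\<rfloor>"
      proof (cases "\<alpha> \<bullet> \<mu> = 0")
        case True
        then have a': "\<alpha> \<in> \<Psi>'" using a by (simp add: \<Psi>'_def)
        have "N.eqv x1 y" "N.eqv x1 (w y)"
          using that(1) wC N.cell_iff unfolding C_def by auto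
        then show ?thesis using a' by (simp add: N.eqv_def)
      next
        case False
        then have "\<alpha> \<bullet> w y < \<alpha> \<bullet> y" using U(3)[of y] that(1) a by auto
        then show ?thesis by (intro floor_mono) simp
      qed
    qed
    then have "straight_at w y" using adm_straight_at[OF w dr _ that(2)] by blast
    from straight_at_minimal[OF w this, of xs] show ?thesis
      using short_eqv[OF w, of g' c y N] that(3) N by simp
  qed
  obtain h1 y1 where h1: "h1 \<in> RG" "y1 \<in> U \<inter> C" "reg y1" "eqv (h1 c) y1" "?S\<^sup>*\<^sup>* g1 h1"
    using enter[OF g1 g1C] by blast
  obtain h3 y3 where h3: "h3 \<in> RG" "y3 \<in> U \<inter> C" "reg y3" "eqv (h3 c) y3" "?S\<^sup>*\<^sup>* h2 h3"
    using enter[OF h2 h2s h2C] by blast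
  have "\<exists>g'. aut g' \<and> eqv (g' c) y3 \<and> ?S\<^sup>*\<^sup>* h1 g'"
    by (rule gallery[of "U \<inter> C" y1 y3 h1 c])
      (use U(1,2) C h1 h3 RG_aut inside in \<open>auto intro: convex_Int\<close>)
  then obtain g' where g': "eqv (g' c) y3" "?S\<^sup>*\<^sup>* h1 g'" by blast
  \<comment> \<open>The gallery ends at an alcove equivalent to that of \<open>h3 c\<close>;
    freeness turns this into equality of group elements.\<close>
  have "g' = h3"
    using RG_eq[OF c gallery_RG[OF g'(2) h1(1)] h3(1) eqv_trans[OF g'(1) eqv_sym[OF h3(4)]]] .
  then have "?S\<^sup>*\<^sup>* h1 h3" using g'(2) by simp
  with h1(5) have "?S\<^sup>*\<^sup>* g1 h3" by (rule rtranclp_trans)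
  with gallery_sym[OF h3(5)] have "?S\<^sup>*\<^sup>* g1 h2" by (meson rtranclp_trans)
  then show ?thesis using zR zw unfolding h2_def by (intro bexI[of _ z] conjI) auto
qed

section \<open>The extended affine Weyl group\<close>

text \<open>Translation by a coroot is a product of two reflections in parallel hyperplanes at
  consecutive levels, and a linear reflection is the affine one at level 0.\<close>

lemma Waff_subset_RG: "Waff \<Psi> \<subseteq> RG"
proof
  fix x assume "x \<in> Waff \<Psi>"
  then obtain q u where q: "q \<in> coroot_lattice \<Psi>" and u: "u \<in> W0 \<Psi>" and x: "x = (\<lambda>y. q + u y)"
    by (auto simp: Waff_def)
  have uR: "u \<in> RG"
    using u
  proof (induction u rule: W0.induct)
    case W0_id
    show ?case by (rule RG_id)
  next
    case (W0_refl u \<alpha>)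
    have "refl \<alpha> = affrefl \<alpha> 0" by (rule ext) (simp add: refl_def affrefl_def)
    then show ?case using RG_affrefl[OF W0_refl(3,2), of 0] by (simp only:)
  qed
  have shift: "affrefl \<alpha> k (affrefl \<alpha> 0 y) = y + of_int k *\<^sub>R coroot \<alpha>" if "\<alpha> \<in> \<Psi>" for \<alpha> k y
  proof -
    have "affrefl \<alpha> k (affrefl \<alpha> 0 y) = affrefl \<alpha> 0 y + (\<alpha> \<bullet> y + of_int k) *\<^sub>R coroot \<alpha>"
      using inner_affrefl[OF root_nonzero[OF that], of 0 y]
      by (simp add: affrefl_def[of \<alpha> k "affrefl \<alpha> 0 y"] algebra_simps)
    then show ?thesis by (simp add: affrefl_def algebra_simps)
  qed
  have shiftR: "(\<lambda>y. y + of_int k *\<^sub>R coroot \<alpha>) \<in> RG" if "\<alpha> \<in> \<Psi>" for \<alpha> k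
  proof -
    have "(\<lambda>y. y + of_int k *\<^sub>R coroot \<alpha>) = affrefl \<alpha> k \<circ> affrefl \<alpha> 0" using shift[OF that] by auto
    then show ?thesis using RG_comp[OF affrefl_in_RG[OF that] affrefl_in_RG[OF that]] by (simp only:)
  qed
  have qR: "(\<lambda>y. q + y) \<in> RG"
    using q
  proof (induction q rule: coroot_lattice.induct)
    case Q_zero
    show ?case using RG_id by (simp add: id_def)
  next
    case (Q_plus q \<alpha>)
    have "(\<lambda>y. (q + coroot \<alpha>) + y) = (\<lambda>y. q + y) \<circ> (\<lambda>y. y + of_int 1 *\<^sub>R coroot \<alpha>)" by auto
    then show ?case using RG_comp[OF Q_plus(3) shiftR[OF Q_plus(2)]] by (simp only:)
  next
    case (Q_minus q \<alpha>)
    have "(\<lambda>y. (q - coroot \<alpha>) + y) = (\<lambda>y. q + y) \<circ> (\<lambda>y. y + of_int (- 1) *\<^sub>R coroot \<alpha>)" by auto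
    then show ?case using RG_comp[OF Q_minus(3) shiftR[OF Q_minus(2)]] by (simp only:)
  qed
  have "x = (\<lambda>y. q + y) \<circ> u" using x by auto
  then show "x \<in> RG" using RG_comp[OF qR uR] by (simp only:)
qed

lemma orthogonal_W0:
  assumes "u \<in> W0 \<Psi>"
  shows "orthogonal_transformation u \<and> u ` \<Psi> = \<Psi>"
  using assms
proof (induction u rule: W0.induct)
  case W0_id
  show ?case using orthogonal_transformation_id[folded id_def] by simp
next
  case (W0_refl u \<alpha>)
  have o: "orthogonal_transformation (refl \<alpha>)"
    using orthogonal_transformation_refl root_nonzero W0_refl(2) by blast
  have "(refl \<alpha> \<circ> u) ` \<Psi> = \<Psi>"
    using W0_refl(3) refl_image[OF W0_refl(2)] by (simp only: image_comp[symmetric])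
  then show ?case using orthogonal_transformation_compose[OF o] W0_refl(3) by blast
qed

lemma aut_Wext:
  assumes \<Phi>p: "\<Psi> = \<Phi>p \<union> uminus ` \<Phi>p" and P: "coweight_lattice \<Psi> P" and \<Omega>: "diagram_group \<Phi>p P \<Omega>"
    and w: "w \<in> Wext \<Psi> P \<Omega>"
  shows "aut w"
proof -
  obtain p u v where p: "p \<in> P" and u: "u \<in> W0 \<Psi>" and v: "v \<in> \<Omega>" and w: "w = (\<lambda>x. p + u (v x))"
    using w by (auto simp: Wext_def)
  have ov: "orthogonal_transformation v" and vp: "v ` \<Phi>p = \<Phi>p"
    using \<Omega> v by (auto simp: diagram_group_def orthogonal_transformation_def)
  have lin: "linear v" using ov by (simp add: orthogonal_transformation_def)
  have "v ` uminus ` \<Phi>p = uminus ` v ` \<Phi>p" by (simp add: image_image linear_neg[OF lin])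
  then have "v ` \<Psi> = \<Psi>" using vp \<Phi>p by (simp add: image_Un)
  then have "(u \<circ> v) ` \<Psi> = \<Psi>" using orthogonal_W0[OF u] by (simp only: image_comp[symmetric])
  moreover have "orthogonal_transformation (u \<circ> v)"
    using orthogonal_transformation_compose orthogonal_W0[OF u] ov by blast
  moreover have "\<forall>\<alpha>\<in>\<Psi>. \<alpha> \<bullet> p \<in> \<int>" using P p by (simp add: coweight_lattice_def)
  ultimately show ?thesis
    unfolding aut_def w by (intro exI[of _ "u \<circ> v"] exI[of _ p]) simp
qed

text \<open>\<open>len\<close> uses positive roots and both orders of the two sides,
  \<open>sep\<close> all roots and one order; negating the pairs of reversed order matches the
  counts. No hyperplane cuts an alcove, so the quantifiers over it reduce to the point
  \<open>c\<close>.\<close>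

lemma len_eq_dst:
  assumes \<Phi>p: "\<Psi> = \<Phi>p \<union> uminus ` \<Phi>p" "\<Phi>p \<inter> uminus ` \<Phi>p = {}"
    and alc: "alcove \<Phi>p = cell c" and c: "reg c" and w: "aut w"
  shows "len \<Phi>p w = dst c (w c)"
proof -
  have wc: "reg (w c)" using reg_aut[OF w c] .
  have cA: "c \<in> alcove \<Phi>p" unfolding alc using cell_iff[of c c] c by simp
  have side: "(\<alpha> \<bullet> x < of_int k \<longleftrightarrow> \<alpha> \<bullet> y < of_int k) \<and> (of_int k < \<alpha> \<bullet> x \<longleftrightarrow> of_int k < \<alpha> \<bullet> y)"
    if "eqv x y" "reg x" "reg y" "\<alpha> \<in> \<Psi>" for x y \<alpha> k
  proof -
    have "\<lfloor>\<alpha> \<bullet> x\<rfloor> = \<lfloor>\<alpha> \<bullet> y\<rfloor>" using that by (simp add: eqv_def)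
    then have "\<alpha> \<bullet> x < of_int k \<longleftrightarrow> \<alpha> \<bullet> y < of_int k" by (metis floor_less_iff)
    then show ?thesis
      using reg_less_iff[OF that(2,4), of k] reg_less_iff[OF that(3,4), of k] by auto
  qed
  have sep_iff: "separates \<Phi>p w \<alpha> k \<longleftrightarrow>
      \<alpha> \<bullet> c < of_int k \<and> of_int k < \<alpha> \<bullet> w c \<or> of_int k < \<alpha> \<bullet> c \<and> \<alpha> \<bullet> w c < of_int k"
    if a: "\<alpha> \<in> \<Psi>" for \<alpha> k
  proof -
    have 1: "(\<alpha> \<bullet> x < of_int k \<longleftrightarrow> \<alpha> \<bullet> c < of_int k) \<and> (of_int k < \<alpha> \<bullet> x \<longleftrightarrow> of_int k < \<alpha> \<bullet> c) \<and>
        (\<alpha> \<bullet> w x < of_int k \<longleftrightarrow> \<alpha> \<bullet> w c < of_int k) \<and> (of_int k < \<alpha> \<bullet> w x \<longleftrightarrow> of_int k < \<alpha> \<bullet> w c)"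
      if "x \<in> alcove \<Phi>p" for x
    proof -
      have x: "eqv c x" "reg x" using that alc cell_iff by auto
      show ?thesis
        using side[OF x(1) c x(2) a, of k] side[OF eqv_autI[OF w x(1)] wc reg_aut[OF w x(2)] a, of k]
        by blast
    qed
    show ?thesis unfolding separates_def using 1 cA by blast
  qed
  define S1 where "S1 = {(\<alpha>, k::int). \<alpha> \<in> \<Phi>p \<and> \<alpha> \<bullet> c < of_int k \<and> of_int k < \<alpha> \<bullet> w c}"
  define S2 where "S2 = {(\<alpha>, k::int). \<alpha> \<in> \<Phi>p \<and> of_int k < \<alpha> \<bullet> c \<and> \<alpha> \<bullet> w c < of_int k}"
  define neg where "neg = (\<lambda>(\<alpha>::'a, k::int). (- \<alpha>, - k))"
  have le: "of_int k \<le> \<alpha> \<bullet> w c \<longleftrightarrow> of_int k < \<alpha> \<bullet> w c" if "\<alpha> \<in> \<Psi>" for \<alpha> k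
    using reg_less_iff[OF wc that] .
  have sub: "\<Phi>p \<subseteq> \<Psi>" using \<Phi>p by auto
  have "{(\<alpha>, k). \<alpha> \<in> \<Phi>p \<and> separates \<Phi>p w \<alpha> k} = S1 \<union> S2"
    using sep_iff sub by (auto simp: S1_def S2_def)
  then have len: "len \<Phi>p w = card (S1 \<union> S2)" by (simp add: len_def)
  have sep: "sep c (w c) = S1 \<union> neg ` S2"
  proof (intro equalityI subsetI)
    fix h assume h: "h \<in> sep c (w c)"
    obtain \<alpha> k where hk: "h = (\<alpha>, k)" by (metis surj_pair)
    have a: "\<alpha> \<in> \<Psi>" "\<alpha> \<bullet> c < of_int k" "of_int k < \<alpha> \<bullet> w c" using h hk le by (auto simp: sep_def)
    show "h \<in> S1 \<union> neg ` S2"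
    proof (cases "\<alpha> \<in> \<Phi>p")
      case True
      then show ?thesis using a hk by (simp add: S1_def)
    next
      case False
      then have "- \<alpha> \<in> \<Phi>p" using a(1) \<Phi>p(1) by auto
      then have "(- \<alpha>, - k) \<in> S2" using a by (simp add: S2_def)
      then have "neg (- \<alpha>, - k) \<in> neg ` S2" by (rule imageI)
      then show ?thesis by (simp add: neg_def hk)
    qed
  next
    fix h assume "h \<in> S1 \<union> neg ` S2"
    then show "h \<in> sep c (w c)" using sub uminus_root by (auto simp: S1_def S2_def neg_def sep_def)
  qed
  have inj: "inj neg" by (auto simp: inj_def neg_def)
  have fin: "finite S1" "finite (neg ` S2)" using finite_sep[of c "w c"] sep by auto
  then have fin2: "finite S2" using inj by (meson finite_imageD inj_on_subset subset_UNIV)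
  have "S1 \<inter> S2 = {}" by (auto simp: S1_def S2_def)
  moreover have "S1 \<inter> neg ` S2 = {}" using \<Phi>p(2) by (auto simp: S1_def S2_def neg_def)
  moreover have "card (neg ` S2) = card S2" using inj by (meson card_image inj_on_subset subset_UNIV)
  ultimately show ?thesis
    unfolding len dst_def sep using fin fin2 by (simp add: card_Un_disjoint)
qed

lemma walls_subset_Ssimple:
  assumes "alcove \<Phi>p = cell c" "reg c"
  shows "walls c \<subseteq> Ssimple \<Psi> \<Phi>p"
proof
  fix s assume "s \<in> walls c"
  then obtain \<alpha> k where s: "s = affrefl \<alpha> k" "\<alpha> \<in> \<Psi>" "sep c (affrefl \<alpha> k c) = {(\<alpha>, k)}"
    by (auto simp: walls_def)
  have "is_wall \<Phi>p \<alpha> k"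
    unfolding is_wall_def assms(1) using half_ball_in_cell[OF assms(2) s(2,3)] by blast
  then show "s \<in> Ssimple \<Psi> \<Phi>p" using s by (auto simp: Ssimple_def)
qed

end

section \<open>From root systems to arrangements, and the conjugacy class\<close>

lemma funpow_conj:
  assumes "bij x"
  shows "(x \<circ> w \<circ> inv x) ^^ m = x \<circ> w ^^ m \<circ> inv x"
proof (induction m)
  case 0
  then show ?case using assms by (auto simp: fun_eq_iff bij_is_surj surj_f_inv_f)
next
  case (Suc m)
  have "inv x (x y) = y" for y using assms by (simp add: bij_is_inj)
  then show ?case using Suc by (auto simp: fun_eq_iff)
qed

lemma affine_arrangement_root_system:
  assumes "reduced_root_system \<Phi>"
  shows "affine_arrangement \<Phi>"
  using assms unfolding reduced_root_system_def affine_arrangement_def by blast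

lemma positive_system_split:
  assumes "reduced_root_system \<Phi>" "positive_system \<Phi> \<Phi>p"
  shows "\<Phi> = \<Phi>p \<union> uminus ` \<Phi>p" "\<Phi>p \<inter> uminus ` \<Phi>p = {}"
proof -
  interpret affine_arrangement \<Phi> using assms(1) by (rule affine_arrangement_root_system)
  obtain \<rho> where \<rho>: "\<forall>\<alpha>\<in>\<Phi>. \<alpha> \<bullet> \<rho> \<noteq> 0" "\<Phi>p = {\<alpha>\<in>\<Phi>. \<alpha> \<bullet> \<rho> > 0}"
    using assms(2) by (auto simp: positive_system_def)
  show "\<Phi>p \<inter> uminus ` \<Phi>p = {}" using \<rho>(2) by auto
  show "\<Phi> = \<Phi>p \<union> uminus ` \<Phi>p"
  proof (intro equalityI subsetI)
    fix \<alpha> assume a: "\<alpha> \<in> \<Phi>"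
    then consider "\<alpha> \<bullet> \<rho> > 0" | "- \<alpha> \<bullet> \<rho> > 0" using \<rho>(1) by fastforce
    then show "\<alpha> \<in> \<Phi>p \<union> uminus ` \<Phi>p"
    proof cases
      case 2
      then have "- \<alpha> \<in> \<Phi>p" using uminus_root[OF a] \<rho>(2) by simp
      then have "- (- \<alpha>) \<in> uminus ` \<Phi>p" by (rule imageI)
      then show ?thesis by simp
    qed (use a \<rho>(2) in simp)
  qed (use \<rho>(2) uminus_root in auto)
qed

lemma alcove_point:
  assumes "finite \<Phi>" "positive_system \<Phi> \<Phi>p"
  obtains c where "c \<in> alcove \<Phi>p"
proof -
  obtain \<rho> where \<rho>: "\<Phi>p = {\<alpha>\<in>\<Phi>. \<alpha> \<bullet> \<rho> > 0}" using assms(2) by (auto simp: positive_system_def)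
  \<comment> \<open>\<open>S\<close> exceeds the value at \<rho> of every positive root, so \<rho>
    scaled by \<open>1 / S\<close> lies in the alcove; the summand 1 also makes \<open>S\<close>
    positive.\<close>
  define S where "S = 1 + (\<Sum>\<alpha>\<in>\<Phi>p. \<alpha> \<bullet> \<rho>)"
  have fin: "finite \<Phi>p" using assms(1) \<rho> by simp
  have lt: "\<alpha> \<bullet> \<rho> < S" if "\<alpha> \<in> \<Phi>p" for \<alpha>
    using member_le_sum[OF that, of "\<lambda>\<alpha>. \<alpha> \<bullet> \<rho>"] fin \<rho> by (auto simp: S_def)
  have "S > 0" unfolding S_def using sum_nonneg[of \<Phi>p "\<lambda>\<alpha>. \<alpha> \<bullet> \<rho>"] \<rho> by (auto intro: add_pos_nonneg)
  then have "(1 / S) *\<^sub>R \<rho> \<in> alcove \<Phi>p" using lt \<rho> by (simp add: alcove_def)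
  then show thesis by (rule that)
qed

theorem theorem3p13:
  fixes \<Phi> \<Phi>p P :: "'a::euclidean_space set" and \<Omega> :: "('a \<Rightarrow> 'a) set"
    and w0 w w' :: "'a \<Rightarrow> 'a"
  assumes "reduced_root_system \<Phi>"
    and "positive_system \<Phi> \<Phi>p"
    and "coweight_lattice \<Phi> P"
    and "diagram_group \<Phi>p P \<Omega>"
    and "w0 \<in> Wext \<Phi> P \<Omega>"
    and "\<exists>x\<in>conj_class \<Phi> w0. straight \<Phi>p x"
    and "w \<in> min_elems \<Phi>p (conj_class \<Phi> w0)"
    and "w' \<in> min_elems \<Phi>p (conj_class \<Phi> w0)"
  shows "approx \<Phi> \<Phi>p w w'"
proof -
  interpret affine_arrangement \<Phi> using assms(1) by (rule affine_arrangement_root_system)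
  note split = positive_system_split[OF assms(1,2)]
  obtain c where c: "c \<in> alcove \<Phi>p" using alcove_point[OF finite_roots assms(2)] .
  have alc: "alcove \<Phi>p = cell c"
  proof -
    \<comment> \<open>At \<open>c\<close> the floors are 0 for positive and -1 for negative roots,
      so the inequalities for \<alpha> and - \<alpha> in the cell both reduce to those of the
      alcove.\<close>
    have fl: "\<lfloor>\<alpha> \<bullet> c\<rfloor> = 0" "\<lfloor>- (\<alpha> \<bullet> c)\<rfloor> = - 1" if "\<alpha> \<in> \<Phi>p" for \<alpha>
      using c that unfolding alcove_def by (auto simp: floor_eq_iff)
    have "x \<in> cell c \<longleftrightarrow> x \<in> alcove \<Phi>p" for x
      unfolding cell_def alcove_def by (subst split(1)) (auto simp: ball_Un fl)
    then show ?thesis by blast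
  qed
  have regc: "reg c" using c cell_iff[of c c] unfolding alc by blast
  have aw: "aut w0" using aut_Wext[OF split(1) assms(3-5)] .
  \<comment> \<open>The dictionary: the length of a conjugate is the distance from the moved base
    alcove to its image.\<close>
  have len: "len \<Phi>p (inv g \<circ> u \<circ> g) = dst (g c) (u (g c))" if "aut u" "g \<in> RG" for u g
  proof -
    have ag: "aut g" using RG_aut that(2) by blast
    have "len \<Phi>p (inv g \<circ> u \<circ> g) = dst c (inv g (u (g c)))"
      using len_eq_dst[OF split alc regc aut_comp[OF aut_comp[OF aut_inv[OF ag] that(1)] ag]] by simp
    also have "\<dots> = dst (g c) (g (inv g (u (g c))))" using dst_aut[OF ag] by simp
    finally show ?thesis using aut_bij[OF ag] by (simp add: bij_is_surj surj_f_inv_f)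
  qed
  have conj: "\<exists>g\<in>RG. v = inv g \<circ> w0 \<circ> g" if vC: "v \<in> conj_class \<Phi> w0" for v
  proof -
    obtain x where x: "x \<in> RG" "v = x \<circ> w0 \<circ> inv x"
      using vC Waff_subset_RG unfolding conj_class_def by blast
    moreover have "inv (inv x) = x" using aut_bij[OF RG_aut[OF x(1)]] by (rule inv_inv_eq)
    ultimately show ?thesis using RG_inv[OF x(1)] by (intro bexI[of _ "inv x"]) (simp_all only:)
  qed
  obtain v where v: "v \<in> conj_class \<Phi> w0" "straight \<Phi>p v" using assms(6) by blast
  obtain g0 where g0: "g0 \<in> RG" "v = inv g0 \<circ> w0 \<circ> g0" using conj[OF v(1)] by blast
  define N where "N = dst (g0 c) (w0 (g0 c))"
  have lenv: "len \<Phi>p v = N" using len[OF aw g0(1)] g0(2) by (simp add: N_def)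
  have st: "straight_at w0 (g0 c)"
    unfolding straight_at_def
  proof
    fix m
    have bij: "bij (inv g0)" "inv (inv g0) = g0"
      using aut_bij[OF RG_aut[OF g0(1)]] by (auto simp: bij_imp_bij_inv inv_inv_eq)
    have "v ^^ m = inv g0 \<circ> w0 ^^ m \<circ> g0"
      using funpow_conj[OF bij(1), where w = w0 and m = m] by (simp only: bij(2) g0(2))
    then have "dst (g0 c) ((w0 ^^ m) (g0 c)) = len \<Phi>p (v ^^ m)"
      using len[OF aut_funpow[OF aw] g0(1)] by (simp only:)
    also have "\<dots> = m * N" using v(2) lenv by (simp add: straight_def)
    finally show "dst (g0 c) ((w0 ^^ m) (g0 c)) = m * dst (g0 c) (w0 (g0 c))" by (simp add: N_def)
  qed
  \<comment> \<open>A gallery step becomes conjugation by a simple reflection. Conjugates of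
    \<open>w0\<close> by the reflection group have length at least \<open>N\<close>, short ones at
    most \<open>N\<close>, so the length does not grow.\<close>
  have steps: "reaches \<Phi> \<Phi>p (inv g \<circ> w0 \<circ> g) (inv g' \<circ> w0 \<circ> g')"
    if "(gallery_step c (short w0 c N))\<^sup>*\<^sup>* g g'" "g \<in> RG" for g g'
    using that
  proof (induction rule: rtranclp_induct)
    case base
    then show ?case by (simp add: reaches_def)
  next
    case (step h h')
    obtain s where s: "s \<in> walls c" "h' = h \<circ> s" and sh: "short w0 c N h'"
      using step.hyps(2) unfolding gallery_step_def by blast
    have h: "h \<in> RG" using gallery_RG[OF step.hyps(1) step.prems] .
    then have hR: "h \<in> RG" "h' \<in> RG" using RG_comp walls_in_RG s by (simp_all only:)
    have "inv s = s" using walls_self[OF s(1)] by (metis inv_unique_comp)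
    then have "inv h' = s \<circ> inv h"
      unfolding s(2) using o_inv_distrib aut_bij RG_aut hR(1) walls_in_RG[OF s(1)] by metis
    then have eq: "inv h' \<circ> w0 \<circ> h' = s \<circ> (inv h \<circ> w0 \<circ> h) \<circ> s" by (simp add: s(2) comp_assoc)
    have "len \<Phi>p (inv h' \<circ> w0 \<circ> h') \<le> N" using len[OF aw hR(2)] sh by (simp add: short_def)
    also have "N \<le> len \<Phi>p (inv h \<circ> w0 \<circ> h)"
      using len[OF aw hR(1)] straight_at_minimal[OF aw st] by (simp add: N_def)
    finally have "cstep \<Phi> \<Phi>p (inv h \<circ> w0 \<circ> h) (inv h' \<circ> w0 \<circ> h')"
      unfolding cstep_def using eq s(1) walls_subset_Ssimple[OF alc regc] by blast
    then show ?case using step.IH[OF step.prems] unfolding reaches_def by (rule rtranclp.rtrancl_into_rtrancl[rotated])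
  qed
  have min: "\<exists>g\<in>RG. short w0 c N g \<and> u = inv g \<circ> w0 \<circ> g" if "u \<in> min_elems \<Phi>p (conj_class \<Phi> w0)" for u
  proof -
    have u: "u \<in> conj_class \<Phi> w0" "len \<Phi>p u \<le> N" using that v(1) lenv by (auto simp: min_elems_def)
    obtain g where g: "g \<in> RG" "u = inv g \<circ> w0 \<circ> g" using conj[OF u(1)] by blast
    then show ?thesis using len[OF aw g(1)] u(2) by (auto simp: short_def)
  qed
  have reach: "reaches \<Phi> \<Phi>p u1 u2"
    if u1: "u1 \<in> min_elems \<Phi>p (conj_class \<Phi> w0)" and u2: "u2 \<in> min_elems \<Phi>p (conj_class \<Phi> w0)" for u1 u2
  proof -
    obtain g1 where g1: "g1 \<in> RG" "short w0 c N g1" "u1 = inv g1 \<circ> w0 \<circ> g1" using min[OF u1] by blast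
    obtain g2 where g2: "g2 \<in> RG" "short w0 c N g2" "u2 = inv g2 \<circ> w0 \<circ> g2" using min[OF u2] by blast
    obtain z where z: "z \<in> RG" "z \<circ> w0 = w0 \<circ> z" "(gallery_step c (short w0 c N))\<^sup>*\<^sup>* g1 (z \<circ> g2)"
      using straight_gallery[OF aw regc st N_def g1(1,2) g2(1,2)] by blast
    have bz: "bij z" and bg: "bij g2" using aut_bij RG_aut z(1) g2(1) by auto
    \<comment> \<open>The factor \<open>z\<close> cancels because it commutes with
      \<open>w0\<close>, so the gallery ends at \<open>u2\<close> itself.\<close>
    have "inv (z \<circ> g2) \<circ> w0 \<circ> (z \<circ> g2) = inv g2 \<circ> (inv z \<circ> (w0 \<circ> z)) \<circ> g2"
      by (simp only: o_inv_distrib[OF bz bg] comp_assoc)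
    also have "inv z \<circ> (w0 \<circ> z) = w0"
      unfolding z(2)[symmetric] using bz by (simp add: comp_assoc[symmetric] bij_is_inj)
    finally show ?thesis using steps[OF z(3) g1(1)] g1(3) g2(3) by (simp only:)
  qed
  show ?thesis unfolding approx_def using reach assms(7,8) by blast
qed

end
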